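(* Let $F$ be a finite field of characteristic $p$ and order $q=p^n$, and let $d$ be a positive integer with $\gcd(d,q-1)=1$ and $d\not\equiv1\pmod{p-1}$. If $d\equiv (p+1)/2\pmod{p-1}$ (which can only happen if $p\equiv1\pmod 4$) and $n$ is odd, then $V_{F,d}\le\frac12[F:\mathbb{F}_p]$. Otherwise $V_{F,d}\le\frac{1}{p-1}\left\lceil\frac{p-1}{3}\right\rceil[F:\mathbb{F}_p]$.
   Context: $\psi$ is the canonical additive character of $F$, $\psi(x)=e^{2\pi i\operatorname{Tr}(x)/p}$ with $\operatorname{Tr}$ the absolute trace $F\to\mathbb{F}_p$. For $a\in F$, $W_{F,d}(a)=\sum_{x\in F}\psi(x^d-ax)$, and $V_{F,d}=\min_{a\in F}\operatorname{val}_p(W_{F,d}(a))$, where $\operatorname{val}_p$ is the $p$-adic valuation extended to $\mathbb{Q}(e^{2\pi i/p})$ with $\operatorname{val}_p(1-e^{2\pi i/p})=1/(p-1)$ (so $\operatorname{val}_p(p)=1$). *)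

theory Defs
  imports
    Complex_Main
    "HOL-Library.Extended_Real"
    "HOL-Library.Cardinality"
    "HOL-Computational_Algebra.Computational_Algebra"
    "HOL-Number_Theory.Cong"
begin

(* The degree of F over its prime field, read off from the order of F. *)
definition ff_degree :: "'a::finite_field itself \<Rightarrow> nat" where
  "ff_degree _ = (THE n. CARD('a) = CHAR('a) ^ n)"

definition abs_trace :: "'a::finite_field \<Rightarrow> 'a" where
  "abs_trace x = (\<Sum>i<ff_degree TYPE('a). x ^ (CHAR('a) ^ i))"

(* The representative in {0..<p} of an element of the prime field of F. *)
definition prime_field_rep :: "'a::finite_field \<Rightarrow> nat" where
  "prime_field_rep y = (THE k. k < CHAR('a) \<and> of_nat k = y)"

definition canonical_char :: "'a::finite_field \<Rightarrow> complex" where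
  "canonical_char x =
     exp (2 * of_real pi * \<i> * of_nat (prime_field_rep (abs_trace x)) / of_nat CHAR('a))"

definition weil_sum :: "nat \<Rightarrow> 'a::finite_field \<Rightarrow> complex" where
  "weil_sum d a = (\<Sum>x\<in>UNIV. canonical_char (x ^ d - a * x))"

definition zeta :: "nat \<Rightarrow> complex" where
  "zeta p = exp (2 * of_real pi * \<i> / of_nat p)"

(* The ring Z[zeta_p]. *)
definition cyclotomic_ints :: "nat \<Rightarrow> complex set" where
  "cyclotomic_ints p = range (\<lambda>f :: int poly. poly (map_poly of_int f) (zeta p))"

(* The complement in Z[zeta_p] of the principal ideal generated by 1 - zeta_p,
   which is the unique prime ideal above p. *)
definition prime_to_p :: "nat \<Rightarrow> complex set" where
  "prime_to_p p = cyclotomic_ints p - (\<lambda>u. (1 - zeta p) * u) ` cyclotomic_ints p"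

(* The p-adic valuation on Q(zeta_p).  A nonzero element of Q(zeta_p) is
   (1 - zeta_p)^k * a / b with a, b in Z[zeta_p] outside the prime above p, for a unique
   integer k; its valuation is k / (p - 1), so that 1 - zeta_p has valuation 1 / (p - 1)
   and p has valuation 1.  Values outside Q(zeta_p) are unspecified. *)
definition val_p :: "nat \<Rightarrow> complex \<Rightarrow> ereal" where
  "val_p p z =
     (if z = 0 then \<infinity>
      else ereal (of_int (THE k :: int. \<exists>a\<in>prime_to_p p. \<exists>b\<in>prime_to_p p.
                    z = (1 - zeta p) powi k * a / b) / (real p - 1)))"

definition weil_val :: "'a::finite_field itself \<Rightarrow> nat \<Rightarrow> ereal" where
  "weil_val _ d = Min (range (\<lambda>a :: 'a. val_p CHAR('a) (weil_sum d a)))"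

end

theory Submission
  imports "HOL-Number_Theory.Residues" Defs
begin

text \<open>
  Let \<open>T\<close> be the Teichmueller character of the field, \<open>\<pi> = 1 - zeta p\<close>, and let \<open>G a\<close> be the Gauss
  sum of \<open>T\<^sup>-\<^sup>a\<close>. If \<open>q - 1\<close> divides \<open>d * a + b\<close> but not \<open>b\<close>, the Fourier coefficient of the Weil sum
  at \<open>T\<^sup>-\<^sup>b\<close> is \<open>G a * G b\<close> up to sign, so some Weil sum is at most as divisible by \<open>\<pi>\<close> as \<open>G a * G b\<close>.
  Of Stickelberger's theorem only the easy half is needed: \<open>G (a + b)\<close> divides \<open>G a * G b\<close> (Jacobi
  sums), \<open>G (p * a) = G a\<close>, and \<open>G 1\<close> is \<open>\<pi>\<close> times a local unit, hence \<open>G a\<close> divides \<open>\<pi>\<close> to the power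
  of the base-\<open>p\<close> digit sum of \<open>a\<close>. It remains to find \<open>a\<close> and \<open>b\<close> of small total digit sum. Constant
  digits \<open>k\<close> and \<open>l\<close> with \<open>p - 1\<close> dividing \<open>d * k + l\<close> suffice unless \<open>d \<equiv> (p + 1) / 2\<close> modulo \<open>p - 1\<close>;
  in that case, for even \<open>n\<close>, digits of period two give total digit sum \<open>(p - 1) / 2\<close> per period.
\<close>

section \<open>Roots of unity and finite fields\<close>

lemma power_cong_if_power_eq_1:
  fixes z :: "'b :: monoid_mult"
  assumes "z ^ m = 1" "[i = j] (mod m)"
  shows "z ^ i = z ^ j"
proof -
  have "z ^ k = z ^ (k mod m)" for k
    using assms(1)
    by (metis div_mult_mod_eq mult.commute mult_1_left power_add power_mult power_one)
  thus ?thesis using assms(2) unfolding cong_def by metis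
qed

lemma zeta_power: "zeta p ^ k = cis (2 * pi * real k / real p)"
proof -
  have "zeta p = cis (2 * pi / real p)" by (simp add: zeta_def cis_conv_exp mult_ac)
  thus ?thesis by (simp add: DeMoivre mult_ac)
qed

lemma zeta_power_self: "p > 0 \<Longrightarrow> zeta p ^ p = 1"
  by (simp add: zeta_power)

lemma bij_betw_zeta_power: "p > 0 \<Longrightarrow> bij_betw (\<lambda>k. zeta p ^ k) {..<p} {z. z ^ p = 1}"
  unfolding zeta_power by (rule bij_betw_roots_unity)

lemma zeta_ne_1:
  assumes "p > 1"
  shows "zeta p \<noteq> 1"
proof
  assume "zeta p = 1"
  hence "zeta p ^ 1 = zeta p ^ 0" by simp
  moreover have "inj_on (\<lambda>k. zeta p ^ k) {..<p}"
    using bij_betw_imp_inj_on[OF bij_betw_zeta_power] assms by simp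
  ultimately have "(1 :: nat) = 0"
    using assms by (metis inj_onD lessThan_iff order.strict_trans zero_less_one)
  thus False by simp
qed

lemma zeta_in_powers:
  assumes p: "prime p" and z: "z ^ p = 1" "z \<noteq> 1"
  shows "\<exists>k. zeta p = z ^ k"
proof -
  have "p > 0" using p by (simp add: prime_gt_0_nat)
  hence "z \<in> (\<lambda>k. zeta p ^ k) ` {..<p}"
    using bij_betw_imp_surj_on[OF bij_betw_zeta_power] z(1) by simp
  then obtain c where c: "c < p" "z = zeta p ^ c" by blast
  have "c > 0" using c z(2) by (cases c) auto
  hence "coprime c p"
    using c(1) p by (metis coprime_commute dvd_imp_le linorder_not_less prime_imp_coprime)
  then obtain k where k: "[c * k = 1] (mod p)" using cong_solve_coprime_nat[of c p] by auto
  have "z ^ k = zeta p ^ (c * k)" by (simp add: c(2) power_mult)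
  also have "\<dots> = zeta p ^ 1" using zeta_power_self[OF \<open>p > 0\<close>] k by (rule power_cong_if_power_eq_1)
  finally show ?thesis by (intro exI[of _ k]) simp
qed

lemma finite_field_has_generator: "\<exists>g :: 'a :: finite_field. g \<noteq> 0 \<and> (\<forall>x. x \<noteq> 0 \<longrightarrow> (\<exists>i. x = g ^ i))"
proof -
  define F :: "'a ring" where
    "F = \<lparr>carrier = UNIV, monoid.mult = (*), one = 1, ring.zero = 0, add = (+)\<rparr>"
  interpret F: Ring.field F
  proof (rule cring.cring_fieldI2)
    show "cring F"
      unfolding F_def
      by (intro cringI abelian_groupI comm_monoidI)
        (auto simp: algebra_simps intro: exI[of _ "- x" for x] add.left_inverse)
  qed (auto simp: F_def intro: right_inverse)
  have pow: "x [^]\<^bsub>F\<^esub> (i :: nat) = x ^ i" for x i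
    by (induction i) (simp_all add: F_def nat_pow_def mult.commute)
  have "finite (carrier F)" by (simp add: F_def)
  from F.finite_field_mult_group_has_gen[OF this] obtain g where
    "g \<in> carrier (mult_of F)" "carrier (mult_of F) = {g [^]\<^bsub>F\<^esub> i | i :: nat. i \<in> UNIV}" by blast
  moreover have "carrier (mult_of F) = UNIV - {0}" by (auto simp: F_def)
  ultimately have "g \<noteq> 0" "UNIV - {0} = {g ^ i | i. True}" by (auto simp add: pow)
  thus ?thesis by (intro exI[of _ g]) blast
qed

lemma CARD_finite_field_gt_1: "CARD('a :: finite_field) > 1"
  using card_mono[of UNIV "{0, 1 :: 'a}"] by simp

lemma of_nat_CARD_eq_0: "of_nat CARD('a) = (0 :: 'a :: finite_field)"
  using CHAR_dvd_CARD of_nat_eq_0_iff_char_dvd by blast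

lemma of_nat_CARD_minus_1: "of_nat (CARD('a) - 1) = (- 1 :: 'a :: finite_field)"
  using CARD_finite_field_gt_1[where 'a = 'a] by (simp add: of_nat_diff of_nat_CARD_eq_0)

lemma power_CARD_minus_1_eq_1:
  fixes x :: "'a :: finite_field"
  assumes "x \<noteq> 0"
  shows "x ^ (CARD('a) - 1) = 1"
proof -
  have "x * x ^ (CARD('a) - 1) = x ^ CARD('a)"
    using CARD_finite_field_gt_1[where 'a = 'a] by (simp flip: power_Suc)
  also have "\<dots> = x * 1" by (simp add: finite_field_power_card_eq_same)
  finally show ?thesis using assms by simp
qed

lemma exists_power_ne_1:
  assumes "\<not> (CARD('a) - 1) dvd k"
  shows "\<exists>u :: 'a :: finite_field. u \<noteq> 0 \<and> u ^ k \<noteq> 1"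
proof -
  define r where "r = k mod (CARD('a) - 1)"
  have r: "0 < r" "r < CARD('a) - 1"
    using assms CARD_finite_field_gt_1[where 'a = 'a] by (auto simp: r_def dvd_eq_mod_eq_0)
  obtain g :: 'a where g: "g \<noteq> 0" "\<And>x. x \<noteq> 0 \<Longrightarrow> \<exists>i. x = g ^ i"
    using finite_field_has_generator by blast
  have "g ^ r \<noteq> 1"
  proof
    assume "g ^ r = 1"
    hence power_mod: "g ^ i = g ^ (i mod r)" for i
      by (rule power_cong_if_power_eq_1) (simp add: cong_def)
    have "UNIV - {0} \<subseteq> (\<lambda>i. g ^ i) ` {..<r}"
    proof
      fix x :: 'a assume "x \<in> UNIV - {0}"
      then obtain i where "x = g ^ i" using g(2)[of x] by blast
      thus "x \<in> (\<lambda>i. g ^ i) ` {..<r}"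
        using power_mod[of i] r(1) by (intro image_eqI[of _ _ "i mod r"]) simp_all
    qed
    hence "card (UNIV - {0 :: 'a}) \<le> r"
      by (metis card_lessThan finite_lessThan surj_card_le)
    thus False using r(2) by (simp add: card_Diff_subset)
  qed
  moreover have "g ^ k = g ^ r"
    using power_CARD_minus_1_eq_1[OF g(1)]
    by (rule power_cong_if_power_eq_1) (simp add: r_def cong_def)
  ultimately show ?thesis using g(1) by metis
qed

lemma bij_power_if_coprime:
  assumes "coprime d (CARD('a) - 1)" "d > 0"
  shows "bij (\<lambda>x :: 'a :: finite_field. x ^ d)"
proof -
  obtain e where e: "[d * e = 1] (mod (CARD('a) - 1))"
    using cong_solve_coprime_nat[OF assms(1)] by auto
  have inverse: "(z ^ d) ^ e = z" if "z \<noteq> 0" for z :: 'a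
    using power_cong_if_power_eq_1[OF power_CARD_minus_1_eq_1[OF that] e] by (simp add: power_mult)
  have "inj (\<lambda>x :: 'a. x ^ d)"
  proof (rule injI)
    fix x y :: 'a assume "x ^ d = y ^ d"
    thus "x = y" using inverse assms(2) by (metis power_eq_0_iff)
  qed
  thus ?thesis by (simp add: bij_def finite_UNIV_inj_surj)
qed

lemma sum_power_reindex:
  fixes f :: "'a :: finite_field \<Rightarrow> 'b :: comm_monoid_add"
  assumes "coprime d (CARD('a) - 1)" "d > 0"
  shows "(\<Sum>x\<in>UNIV. f (x ^ d)) = (\<Sum>x\<in>UNIV. f x)"
  by (rule sum.reindex_bij_betw[OF bij_power_if_coprime[OF assms]])

lemma coprime_CHAR_CARD_minus_1: "coprime CHAR('a :: finite_field) (CARD('a) - 1)"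
proof -
  have "coprime CARD('a) (CARD('a) - 1)"
    using CARD_finite_field_gt_1[where 'a = 'a] by (intro coprime_diff_one_right_nat) simp
  thus ?thesis using CHAR_dvd_CARD[where 'a = 'a] coprime_divisors dvd_refl by blast
qed

lemma sum_multiplicative_eq_0:
  fixes \<chi> :: "'a :: finite_field \<Rightarrow> 'b :: idom"
  assumes mult: "\<And>x y. \<chi> (x * y) = \<chi> x * \<chi> y" and u: "u \<noteq> 0" "\<chi> u \<noteq> 1"
  shows "(\<Sum>x\<in>UNIV. \<chi> x) = 0"
proof -
  have "(\<Sum>x\<in>UNIV. \<chi> x) = (\<Sum>x\<in>UNIV. \<chi> (u * x))"
    by (rule sum.reindex_bij_witness[of _ "\<lambda>x. u * x" "\<lambda>x. x / u"]) (use u(1) in auto)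
  also have "\<dots> = \<chi> u * (\<Sum>x\<in>UNIV. \<chi> x)" by (simp add: mult sum_distrib_left)
  finally show ?thesis using u(2) by (metis mult_cancel_right2)
qed

lemma sum_inverse_mult_power:
  assumes "0 < k" "k < CARD('a)"
  shows "(\<Sum>x\<in>UNIV. inverse x * x ^ k) = (if k = 1 then - 1 else 0 :: 'a :: finite_field)"
proof (cases "k = 1")
  case True
  have "(\<Sum>x\<in>UNIV. inverse x * x) = (\<Sum>x\<in>UNIV - {0 :: 'a}. 1 :: 'a)"
    by (intro sum.mono_neutral_cong_right) auto
  also have "\<dots> = of_nat (CARD('a) - 1)" by (simp add: card_Diff_subset)
  finally show ?thesis using True by (simp add: of_nat_CARD_minus_1 del: One_nat_def)
next
  case False
  hence "k > 1" using assms(1) by simp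
  hence "\<not> (CARD('a) - 1) dvd k - 1" using assms(2) by (auto dest: dvd_imp_le)
  then obtain u :: 'a where u: "u \<noteq> 0" "u ^ (k - 1) \<noteq> 1" using exists_power_ne_1 by blast
  have "inverse x * x ^ k = x ^ (k - 1)" for x :: 'a
    using \<open>k > 1\<close> by (cases k; cases "x = 0") simp_all
  hence "(\<Sum>x\<in>UNIV. inverse x * x ^ k) = (\<Sum>x\<in>UNIV. x ^ (k - 1) :: 'a)" by simp
  also have "\<dots> = 0"
    using u by (intro sum_multiplicative_eq_0[of _ u]) (simp_all add: power_mult_distrib)
  finally show ?thesis using False by simp
qed

section \<open>The trace and the canonical character\<close>

lemma of_nat_power_CHAR: "(of_nat k :: 'a :: finite_field) ^ CHAR('a) = of_nat k"
  using freshmans_dream_sum[of "CHAR('a)" "\<lambda>_. 1 :: 'a" "{..<k}"] by simp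

lemma exists_of_nat_if_power_CHAR_eq:
  fixes y :: "'a :: finite_field"
  assumes "y ^ CHAR('a) = y"
  shows "\<exists>k<CHAR('a). of_nat k = y"
proof -
  define p where "p = CHAR('a)"
  have p: "p > 1" unfolding p_def by (intro prime_gt_1_nat CHAR_prime)
  define f :: "'a poly" where "f = Polynomial.monom 1 p - [:0, 1:]"
  have f: "poly f x = 0 \<longleftrightarrow> x ^ p = x" for x by (simp add: f_def poly_monom)
  have "Polynomial.coeff f p = 1" using p by (simp add: f_def coeff_eq_0)
  hence "f \<noteq> 0" by auto
  moreover have "degree f \<le> p"
    unfolding f_def using p by (intro degree_diff_le) (auto simp: degree_monom_eq)
  ultimately have "card {x. poly f x = 0} \<le> p" using card_poly_roots_bound le_trans by blast
  moreover have "inj_on (of_nat :: nat \<Rightarrow> 'a) {..<p}"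
    by (auto simp: inj_on_def of_nat_eq_iff_cong_CHAR p_def cong_less_modulus_unique_nat)
  hence "card (of_nat ` {..<p} :: 'a set) = p" by (simp add: card_image)
  moreover have "of_nat ` {..<p} \<subseteq> {x. poly f x = 0}" by (auto simp: f p_def of_nat_power_CHAR)
  ultimately have "of_nat ` {..<p} = {x. poly f x = 0}"
    by (intro card_seteq) (simp_all add: poly_roots_finite \<open>f \<noteq> 0\<close>)
  moreover have "poly f y = 0" using assms by (simp add: f p_def)
  ultimately have "y \<in> of_nat ` {..<p}" by blast
  thus ?thesis by (auto simp: p_def)
qed

lemma of_nat_prime_field_rep:
  fixes y :: "'a :: finite_field"
  assumes "y ^ CHAR('a) = y"
  shows "of_nat (prime_field_rep y) = y"
proof -
  have "\<exists>!k. k < CHAR('a) \<and> of_nat k = y"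
  proof (rule ex_ex1I)
    show "\<exists>k. k < CHAR('a) \<and> of_nat k = y" using exists_of_nat_if_power_CHAR_eq[OF assms] by blast
    show "j = k" if "j < CHAR('a) \<and> of_nat j = y" "k < CHAR('a) \<and> of_nat k = y" for j k
      using that by (metis of_nat_eq_iff_cong_CHAR cong_less_modulus_unique_nat)
  qed
  from theI'[OF this] show ?thesis unfolding prime_field_rep_def by blast
qed

lemma abs_trace_add: "abs_trace (x + y :: 'a :: finite_field) = abs_trace x + abs_trace y"
  unfolding abs_trace_def sum.distrib[symmetric]
  by (intro sum.cong refl freshmans_dream') auto

definition trace_rep :: "'a :: finite_field \<Rightarrow> nat" where
  "trace_rep x = prime_field_rep (abs_trace x)"

lemma canonical_char_eq: "canonical_char (x :: 'a :: finite_field) = zeta CHAR('a) ^ trace_rep x"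
  by (simp add: canonical_char_def zeta_def trace_rep_def mult_ac flip: exp_of_nat_mult)

locale finite_field_of_degree =
  fixes F :: "'a :: finite_field itself" and p n :: nat
  assumes CHAR_eq [simp]: "CHAR('a) = p" and CARD_eq: "CARD('a) = p ^ n"
begin

abbreviation \<psi> :: "'a \<Rightarrow> complex" where "\<psi> \<equiv> canonical_char"

lemma prime_p: "prime p"
  unfolding CHAR_eq[symmetric] by (rule CHAR_prime)

lemmas p_pos = prime_gt_0_nat[OF prime_p] and p_gt_1 = prime_gt_1_nat[OF prime_p]

lemma n_pos: "n > 0"
  using CARD_eq CARD_finite_field_gt_1[where 'a = 'a] by (cases n) auto

lemma ff_degree_eq: "ff_degree TYPE('a) = n"
  unfolding ff_degree_def
proof (rule the_equality)
  show "m = n" if "CARD('a) = CHAR('a) ^ m" for m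
    using that CARD_eq p_gt_1 by (metis CHAR_eq power_inject_exp)
qed (simp add: CARD_eq)

lemma abs_trace_eq: "abs_trace (x :: 'a) = (\<Sum>i<n. x ^ (p ^ i))"
  by (simp add: abs_trace_def ff_degree_eq)

lemma abs_trace_power_CHAR: "abs_trace (x ^ p) = abs_trace (x :: 'a)"
proof -
  have "x + abs_trace (x ^ p) = (\<Sum>i<Suc n. x ^ (p ^ i))"
    by (subst sum.lessThan_Suc_shift) (simp add: abs_trace_eq flip: power_mult)
  also have "\<dots> = x + abs_trace x"
    by (simp add: abs_trace_eq finite_field_power_card_eq_same flip: CARD_eq)
  finally show ?thesis by simp
qed

lemma abs_trace_in_prime_field: "abs_trace (x :: 'a) ^ p = abs_trace x"
proof -
  have "abs_trace x ^ p = (\<Sum>i<n. (x ^ (p ^ i)) ^ p)"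
    unfolding abs_trace_eq by (rule freshmans_dream_sum) (simp_all add: prime_p)
  also have "\<dots> = abs_trace (x ^ p)" by (simp add: abs_trace_eq mult.commute flip: power_mult)
  finally show ?thesis by (simp only: abs_trace_power_CHAR)
qed

lemma of_nat_trace_rep: "of_nat (trace_rep x) = abs_trace (x :: 'a)"
  unfolding trace_rep_def by (rule of_nat_prime_field_rep) (simp add: abs_trace_in_prime_field)

lemma canonical_char_add: "\<psi> (x + y) = \<psi> x * \<psi> y"
proof -
  have "of_nat (trace_rep (x + y)) = (of_nat (trace_rep x + trace_rep y) :: 'a)"
    by (simp add: of_nat_trace_rep abs_trace_add)
  hence "[trace_rep (x + y) = trace_rep x + trace_rep y] (mod p)"
    by (simp only: of_nat_eq_iff_cong_CHAR CHAR_eq)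
  with zeta_power_self[OF p_pos] show ?thesis
    unfolding canonical_char_eq CHAR_eq power_add[symmetric] by (rule power_cong_if_power_eq_1)
qed

lemma canonical_char_power_CHAR: "\<psi> (x ^ p) = \<psi> x"
  by (simp add: canonical_char_eq trace_rep_def abs_trace_power_CHAR)

lemma sum_inverse_mult_abs_trace: "(\<Sum>x\<in>UNIV. inverse x * abs_trace (x :: 'a)) = - 1"
proof -
  have "(\<Sum>x\<in>UNIV. inverse x * x ^ (p ^ i)) = (if i = 0 then - 1 else 0 :: 'a)" if "i < n" for i
  proof -
    have "p ^ i < CARD('a)" unfolding CARD_eq using that p_gt_1 by simp
    moreover have "p ^ i = 1 \<longleftrightarrow> i = 0" using p_gt_1 by (auto simp: power_eq_1_iff)
    ultimately show ?thesis using sum_inverse_mult_power[of "p ^ i", where 'a = 'a] p_pos by simp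
  qed
  hence "(\<Sum>i<n. \<Sum>x\<in>UNIV. inverse x * x ^ (p ^ i)) = (\<Sum>i<n. if i = 0 then - 1 else 0 :: 'a)"
    by (intro sum.cong) auto
  thus ?thesis
    using n_pos by (subst (asm) sum.swap) (simp add: abs_trace_eq sum_distrib_left)
qed

end

section \<open>Gauss sums and Weil sums\<close>

text \<open>With \<open>\<chi> 0 = 0\<close>, also for the trivial character, all sums can run over the whole field.\<close>

definition multiplicative_character :: "('a :: finite_field \<Rightarrow> complex) \<Rightarrow> bool" where
  "multiplicative_character \<chi> \<longleftrightarrow> \<chi> 0 = 0 \<and> \<chi> 1 = 1 \<and> (\<forall>x y. \<chi> (x * y) = \<chi> x * \<chi> y)"

lemma multiplicative_characterD:
  assumes "multiplicative_character \<chi>"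
  shows "\<chi> 0 = 0" "\<chi> 1 = 1" "\<chi> (x * y) = \<chi> x * \<chi> y"
  using assms by (simp_all add: multiplicative_character_def)

definition gauss_sum :: "('a :: finite_field \<Rightarrow> complex) \<Rightarrow> complex" where
  "gauss_sum \<chi> = (\<Sum>x\<in>UNIV. \<chi> x * canonical_char x)"

definition jacobi_sum :: "('a :: finite_field \<Rightarrow> complex) \<Rightarrow> ('a \<Rightarrow> complex) \<Rightarrow> complex" where
  "jacobi_sum \<chi> \<theta> = (\<Sum>x\<in>UNIV. \<chi> x * \<theta> (1 - x))"

lemma sum_character_convolution:
  assumes \<chi>: "multiplicative_character \<chi>" and \<theta>: "multiplicative_character \<theta>"
    and nontrivial: "u \<noteq> 0" "\<chi> u * \<theta> u \<noteq> 1"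
  shows "(\<Sum>x\<in>UNIV. \<chi> x * \<theta> (t - x)) = jacobi_sum \<chi> \<theta> * (\<chi> t * \<theta> t)"
proof (cases "t = 0")
  case True
  note mult = multiplicative_characterD(3)[OF \<chi>] multiplicative_characterD(3)[OF \<theta>]
  have "\<chi> x * \<theta> (t - x) = \<theta> (- 1) * (\<chi> x * \<theta> x)" for x
    using mult(2)[of "- 1" x] True by simp
  hence "(\<Sum>x\<in>UNIV. \<chi> x * \<theta> (t - x)) = \<theta> (- 1) * (\<Sum>x\<in>UNIV. \<chi> x * \<theta> x)"
    by (simp only: sum_distrib_left)
  also have "(\<Sum>x\<in>UNIV. \<chi> x * \<theta> x) = 0"
    using nontrivial by (intro sum_multiplicative_eq_0[of _ u]) (simp_all add: mult)
  finally show ?thesis using True multiplicative_characterD(1)[OF \<chi>] by simp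
next
  case False
  have "(\<Sum>x\<in>UNIV. \<chi> x * \<theta> (t - x)) = (\<Sum>x\<in>UNIV. \<chi> (t * x) * \<theta> (t * (1 - x)))"
    by (rule sum.reindex_bij_witness[of _ "\<lambda>x. t * x" "\<lambda>x. x / t"])
      (use False in \<open>auto simp: algebra_simps\<close>)
  thus ?thesis
    by (simp add: jacobi_sum_def sum_distrib_left sum_distrib_right mult_ac
        multiplicative_characterD(3)[OF \<chi>] multiplicative_characterD(3)[OF \<theta>])
qed

context finite_field_of_degree
begin

lemma gauss_sum_mult:
  fixes \<chi> \<theta> :: "'a \<Rightarrow> complex"
  assumes "multiplicative_character \<chi>" "multiplicative_character \<theta>"
    and "u \<noteq> 0" "\<chi> u * \<theta> u \<noteq> 1"
  shows "gauss_sum \<chi> * gauss_sum \<theta> = jacobi_sum \<chi> \<theta> * gauss_sum (\<lambda>x. \<chi> x * \<theta> x)"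
proof -
  have "gauss_sum \<chi> * gauss_sum \<theta> = (\<Sum>x\<in>UNIV. \<Sum>y\<in>UNIV. \<chi> x * \<theta> y * \<psi> (x + y))"
    by (simp add: gauss_sum_def sum_product canonical_char_add mult_ac)
  also have "\<dots> = (\<Sum>x\<in>UNIV. \<Sum>t\<in>UNIV. \<chi> x * \<theta> (t - x) * \<psi> t)"
  proof (rule sum.cong[OF refl])
    fix x
    show "(\<Sum>y\<in>UNIV. \<chi> x * \<theta> y * \<psi> (x + y)) = (\<Sum>t\<in>UNIV. \<chi> x * \<theta> (t - x) * \<psi> t)"
      by (rule sum.reindex_bij_witness[of _ "\<lambda>t. t - x" "\<lambda>y. x + y"]) auto
  qed
  also have "\<dots> = (\<Sum>t\<in>UNIV. (\<Sum>x\<in>UNIV. \<chi> x * \<theta> (t - x)) * \<psi> t)"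
    by (subst sum.swap) (simp add: sum_distrib_right)
  also have "\<dots> = jacobi_sum \<chi> \<theta> * gauss_sum (\<lambda>x. \<chi> x * \<theta> x)"
    unfolding sum_character_convolution[OF assms]
    by (simp add: gauss_sum_def sum_distrib_left mult_ac)
  finally show ?thesis .
qed

lemma gauss_sum_power_CHAR: "gauss_sum (\<lambda>x :: 'a. \<chi> (x ^ p)) = gauss_sum \<chi>"
  using sum_power_reindex[OF coprime_CHAR_CARD_minus_1 CHAR_pos, of "\<lambda>x :: 'a. \<chi> x * \<psi> x"]
  by (simp add: gauss_sum_def canonical_char_power_CHAR)

lemma sum_character_mult_dilated_char:
  fixes x :: 'a
  assumes "multiplicative_character \<theta>" "x \<noteq> 0"
  shows "(\<Sum>c\<in>UNIV. \<theta> c * \<psi> (- (c * x))) = \<theta> (- 1) * \<theta> (inverse x) * gauss_sum \<theta>"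
proof -
  note mult = multiplicative_characterD(3)[OF assms(1)]
  have "\<theta> (- y / x) = \<theta> (- 1) * \<theta> (inverse x) * \<theta> y" for y
    using mult[of "- 1" "inverse x * y"] mult[of "inverse x" y] by (simp add: field_simps)
  moreover have "(\<Sum>c\<in>UNIV. \<theta> c * \<psi> (- (c * x))) = (\<Sum>y\<in>UNIV. \<theta> (- y / x) * \<psi> y)"
    by (rule sum.reindex_bij_witness[of _ "\<lambda>y. - y / x" "\<lambda>c. - (c * x)"]) (use assms(2) in auto)
  ultimately show ?thesis by (simp add: gauss_sum_def sum_distrib_left mult_ac)
qed

lemma sum_character_mult_weil_sum:
  assumes \<chi>: "multiplicative_character \<chi>" and \<theta>: "multiplicative_character \<theta>"
    and nontrivial: "u \<noteq> 0" "\<theta> u \<noteq> 1" and d: "coprime d (CARD('a) - 1)" "d > 0"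
    and inverse: "\<And>x :: 'a. x \<noteq> 0 \<Longrightarrow> \<theta> (inverse x) = \<chi> (x ^ d)"
  shows "(\<Sum>c\<in>UNIV. \<theta> c * weil_sum d c) = \<theta> (- 1) * gauss_sum \<theta> * gauss_sum \<chi>"
proof -
  have inner: "(\<Sum>c\<in>UNIV. \<theta> c * \<psi> (- (c * x))) = \<theta> (- 1) * gauss_sum \<theta> * \<chi> (x ^ d)" for x
  proof (cases "x = 0")
    case True
    have "(\<Sum>c\<in>UNIV. \<theta> c) = 0"
      using nontrivial by (intro sum_multiplicative_eq_0[of _ u] multiplicative_characterD[OF \<theta>])
    thus ?thesis
      using True d(2) multiplicative_characterD(1)[OF \<chi>]
      by (simp add: power_0_left flip: sum_distrib_right)
  qed (simp add: sum_character_mult_dilated_char[OF \<theta>] inverse mult_ac)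
  have "\<psi> (x ^ d - c * x) = \<psi> (x ^ d) * \<psi> (- (c * x))" for x c
    using canonical_char_add[of "x ^ d" "- (c * x)"] by simp
  hence "\<theta> c * weil_sum d c = (\<Sum>x\<in>UNIV. \<psi> (x ^ d) * (\<theta> c * \<psi> (- (c * x))))" for c
    by (simp add: weil_sum_def sum_distrib_left mult.left_commute)
  hence "(\<Sum>c\<in>UNIV. \<theta> c * weil_sum d c)
      = (\<Sum>c\<in>UNIV. \<Sum>x\<in>UNIV. \<psi> (x ^ d) * (\<theta> c * \<psi> (- (c * x))))" by simp
  also have "\<dots> = (\<Sum>x\<in>UNIV. \<psi> (x ^ d) * (\<Sum>c\<in>UNIV. \<theta> c * \<psi> (- (c * x))))"
    by (subst sum.swap) (simp only: sum_distrib_left)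
  also have "\<dots> = \<theta> (- 1) * gauss_sum \<theta> * (\<Sum>x\<in>UNIV. \<chi> (x ^ d) * \<psi> (x ^ d))"
    unfolding inner by (simp add: sum_distrib_left mult_ac)
  also have "(\<Sum>x\<in>UNIV. \<chi> (x ^ d) * \<psi> (x ^ d)) = gauss_sum \<chi>"
    unfolding gauss_sum_def by (rule sum_power_reindex[OF d])
  finally show ?thesis .
qed

end

section \<open>Lifting a finite field to the complex numbers\<close>

abbreviation ipoly :: "int poly \<Rightarrow> 'b :: comm_ring_1 \<Rightarrow> 'b" where
  "ipoly h x \<equiv> poly (map_poly of_int h) x"

lemma ipoly_pCons [simp]: "ipoly (pCons c h) x = of_int c + x * ipoly h x"
  by (simp add: map_poly_pCons)

lemma ipoly_add [simp]: "ipoly (f + h) x = ipoly f x + ipoly h x"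
  by (induction f h rule: poly_induct2) (simp_all add: algebra_simps)

lemma ipoly_diff [simp]: "ipoly (f - h) x = ipoly f x - ipoly h x"
  using ipoly_add[of "f - h" h x] by (simp add: algebra_simps)

lemma ipoly_smult [simp]: "ipoly (smult c h) x = of_int c * ipoly h x"
  by (induction h) (simp_all add: algebra_simps)

lemma ipoly_mult [simp]: "ipoly (f * h) x = ipoly f x * ipoly h x"
  by (induction f) (simp_all add: algebra_simps)

lemma ipoly_1 [simp]: "ipoly 1 x = 1"
  by (simp add: one_pCons del: poly_1)

lemma ipoly_power [simp]: "ipoly (h ^ k) x = ipoly h x ^ k"
  by (induction k) simp_all

lemma ipoly_sum [simp]: "ipoly (\<Sum>i\<in>A. f i) x = (\<Sum>i\<in>A. ipoly (f i) x)"
  by (induction A rule: infinite_finite_induct) simp_all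

lemma exists_common_pseudo_divisor:
  fixes x :: "'b :: comm_ring_1"
  assumes "f \<noteq> 0" "ipoly f x = 0"
  obtains m where "ipoly m x = 0" "\<And>h. ipoly h x = 0 \<Longrightarrow> \<exists>c s. c \<noteq> 0 \<and> smult c h = m * s"
proof -
  obtain m where m: "m \<noteq> 0" "ipoly m x = 0"
    and least: "\<And>h. h \<noteq> 0 \<Longrightarrow> ipoly h x = 0 \<Longrightarrow> degree m \<le> degree h"
    using ex_has_least_nat[of "\<lambda>h. h \<noteq> 0 \<and> ipoly h x = 0" f degree] assms by blast
  have "\<exists>c s. c \<noteq> 0 \<and> smult c h = m * s" if h: "ipoly h x = 0" for h
  proof -
    obtain s r where sr: "pseudo_divmod h m = (s, r)" by force
    obtain c where c: "c \<noteq> 0" "smult c h = m * s + r"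
      using pseudo_divmod(1)[OF m(1) sr] m(1) by (metis leading_coeff_0_iff power_not_zero)
    have "ipoly (smult c h) x = ipoly (m * s + r) x" by (simp only: c(2))
    hence "ipoly r x = 0" using m(2) h by simp
    hence "r = 0" using least pseudo_divmod(2)[OF m(1) sr] by (meson linorder_not_less)
    thus ?thesis using c by auto
  qed
  thus ?thesis using that m(2) by blast
qed

lemma prime_elem_dvd_if_common_root:
  fixes x :: "'b :: {idom, ring_char_0}"
  assumes f: "prime_elem f" "degree f > 0" "ipoly f x = 0" and h: "ipoly h x = 0"
  shows "f dvd h"
proof -
  have "f \<noteq> 0" using f(2) by auto
  then obtain m where m: "ipoly m x = 0"
    and pseudo_dvd: "\<And>h. ipoly h x = 0 \<Longrightarrow> \<exists>c s. c \<noteq> 0 \<and> smult c h = m * s"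
    using f(3) by (rule exists_common_pseudo_divisor) blast
  obtain c s where f_eq: "c \<noteq> 0" "smult c f = m * s" using pseudo_dvd[OF f(3)] by blast
  obtain c' s' where h_eq: "c' \<noteq> 0" "smult c' h = m * s'" using pseudo_dvd[OF h] by blast
  have "f dvd m * s" unfolding f_eq(2)[symmetric] by (rule dvd_smult) simp
  then consider "f dvd m" | "f dvd s" using f(1) prime_elem_dvd_mult_iff by blast
  thus ?thesis
  proof cases
    case 1
    hence "f dvd [:c':] * h" using h_eq(2) by simp
    moreover have "\<not> f dvd [:c':]" using f(2) h_eq(1) by (auto dest: dvd_imp_degree_le)
    ultimately show ?thesis using f(1) prime_elem_dvd_mult_iff by blast
  next
    case 2
    then obtain u where "s = f * u" by blast
    hence "f * [:c:] = f * (m * u)" using f_eq(2) by (simp add: mult_ac)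
    hence "[:c:] = m * u" using \<open>f \<noteq> 0\<close> by (metis mult_left_cancel)
    hence "ipoly [:c:] x = ipoly (m * u) x" by simp
    hence "of_int c = (0 :: 'b)" using m by simp
    thus ?thesis using f_eq(1) by simp
  qed
qed

lemma exists_prime_elem_factor_with_root:
  fixes x :: "'b :: idom"
  assumes "h \<noteq> 0" "ipoly h x = 0"
  shows "\<exists>f. prime_elem f \<and> f dvd h \<and> ipoly f x = 0"
  using assms
proof (induction h rule: prime_divisors_induct)
  case (unit h)
  then obtain k where "1 = h * k" by blast
  hence "ipoly 1 x = ipoly (h * k) x" by simp
  thus ?case using unit.prems by simp
next
  case (factor f h)
  show ?case
  proof (cases "ipoly f x = 0")
    case True
    thus ?thesis using factor.hyps by (intro exI[of _ f]) auto
  next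
    case False
    thus ?thesis using factor.prems factor.IH by (auto intro: dvd_mult)
  qed
qed simp

lemma exists_reduction_from_complex:
  fixes g :: "'b :: idom"
  assumes "content h = 1" "ipoly h g = 0"
  shows "\<exists>(\<eta> :: complex) red. ipoly h \<eta> = 0 \<and> (\<forall>k. red (ipoly k \<eta>) = ipoly k g)"
proof -
  have "h \<noteq> 0" using assms(1) by auto
  then obtain f where f: "prime_elem f" "f dvd h" "ipoly f g = 0"
    using exists_prime_elem_factor_with_root assms(2) by blast
  have "degree f > 0"
  proof (rule ccontr)
    assume "\<not> degree f > 0"
    then obtain c where "f = [:c:]" using degree_eq_zeroE by blast
    hence "f dvd 1"
      using f(2) assms(1) by (simp add: const_poly_dvd_iff_dvd_content is_unit_const_poly_iff)
    thus False using f(1) by (auto simp: prime_elem_def)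
  qed
  moreover have "degree (map_poly of_int f :: complex poly) = degree f"
    by (rule degree_map_poly) simp
  ultimately obtain \<eta> :: complex where \<eta>: "ipoly f \<eta> = 0"
    using alg_closed_imp_poly_has_root[of "map_poly of_int f :: complex poly"] by auto
  define red where "red = (\<lambda>z. ipoly (SOME k. ipoly k \<eta> = z) g)"
  have red: "red (ipoly k \<eta>) = ipoly k g" for k
  proof -
    define k' where "k' = (SOME k'. ipoly k' \<eta> = ipoly k \<eta>)"
    have "ipoly k' \<eta> = ipoly k \<eta>" unfolding k'_def by (rule someI_ex) blast
    hence "f dvd k' - k"
      by (intro prime_elem_dvd_if_common_root[OF f(1) \<open>degree f > 0\<close> \<eta>]) simp
    then obtain r where "k' - k = f * r" by blast
    hence "ipoly (k' - k) g = ipoly (f * r) g" by simp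
    thus ?thesis using f(3) by (simp add: red_def k'_def)
  qed
  have "ipoly h \<eta> = 0" using f(2) \<eta> by (auto elim!: dvdE)
  thus ?thesis using red by blast
qed

locale complex_subring_hom =
  fixes R :: "complex set" and red :: "complex \<Rightarrow> 'a :: field"
  assumes one_in [simp, intro]: "1 \<in> R"
    and diff_in [simp, intro]: "x \<in> R \<Longrightarrow> y \<in> R \<Longrightarrow> x - y \<in> R"
    and mult_in [simp, intro]: "x \<in> R \<Longrightarrow> y \<in> R \<Longrightarrow> x * y \<in> R"
    and red_1 [simp]: "red 1 = 1"
    and red_diff [simp]: "x \<in> R \<Longrightarrow> y \<in> R \<Longrightarrow> red (x - y) = red x - red y"
    and red_mult [simp]: "x \<in> R \<Longrightarrow> y \<in> R \<Longrightarrow> red (x * y) = red x * red y"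
begin

lemma zero_in [simp, intro]: "0 \<in> R" and red_0 [simp]: "red 0 = 0"
  using diff_in[OF one_in one_in] red_diff[OF one_in one_in] by simp_all

lemma uminus_in [simp, intro]: "x \<in> R \<Longrightarrow> - x \<in> R"
  and red_uminus [simp]: "x \<in> R \<Longrightarrow> red (- x) = - red x"
  using diff_in[OF zero_in, of x] red_diff[OF zero_in, of x] by simp_all

lemma add_in [simp, intro]: "x \<in> R \<Longrightarrow> y \<in> R \<Longrightarrow> x + y \<in> R"
  and red_add [simp]: "x \<in> R \<Longrightarrow> y \<in> R \<Longrightarrow> red (x + y) = red x + red y"
  using diff_in[of x "- y"] red_diff[of x "- y"] by simp_all

lemma power_in [simp, intro]: "x \<in> R \<Longrightarrow> x ^ k \<in> R"
  by (induction k) simp_all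

lemma red_power [simp]: "x \<in> R \<Longrightarrow> red (x ^ k) = red x ^ k"
  by (induction k) simp_all

lemma sum_in [simp, intro]: "(\<And>i. i \<in> A \<Longrightarrow> f i \<in> R) \<Longrightarrow> sum f A \<in> R"
  by (induction A rule: infinite_finite_induct) simp_all

lemma red_sum: "(\<And>i. i \<in> A \<Longrightarrow> f i \<in> R) \<Longrightarrow> red (sum f A) = (\<Sum>i\<in>A. red (f i))"
  by (induction A rule: infinite_finite_induct) simp_all

lemma of_nat_in: "of_nat m \<in> R" and red_of_nat: "red (of_nat m) = of_nat m"
  by (induction m) simp_all

lemma of_int_in [simp, intro]: "of_int k \<in> R" and red_of_int [simp]: "red (of_int k) = of_int k"
  by (cases k rule: int_cases2; simp add: of_nat_in red_of_nat)+

lemma ipoly_in: "x \<in> R \<Longrightarrow> ipoly h x \<in> R" and red_ipoly: "x \<in> R \<Longrightarrow> red (ipoly h x) = ipoly h (red x)"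
  by (induction h) simp_all

lemma root_of_unity_eq_1:
  assumes "w \<in> R" "w ^ k = 1" "red w = 1" "of_nat k \<noteq> (0 :: 'a)"
  shows "w = 1"
proof (rule ccontr)
  assume "w \<noteq> 1"
  hence "(\<Sum>j<k. w ^ j) = 0" using power_diff_1_eq[of w k] assms(2) by simp
  hence "red (\<Sum>j<k. w ^ j) = 0" by simp
  thus False using assms by (simp add: red_sum)
qed

lemma roots_of_unity_eqI:
  assumes "w \<in> R" "w ^ k = 1" "w' \<in> R" "w' ^ k = 1" "red w = red w'" "of_nat k \<noteq> (0 :: 'a)"
  shows "w = w'"
proof (cases k)
  case (Suc m)
  have inverse: "w' ^ m * w' = 1" using assms(4) by (simp add: Suc mult.commute)
  have "red (w' ^ m * w) = red (w' ^ m * w')" using assms(1,3,5) by simp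
  hence red: "red (w' ^ m * w) = 1" by (simp only: inverse red_1)
  have in_R: "w' ^ m * w \<in> R" using assms(1,3) by simp
  have "(w' ^ m * w) ^ k = (w' ^ k) ^ m * w ^ k"
    by (simp add: power_mult_distrib mult.commute flip: power_mult)
  hence root: "(w' ^ m * w) ^ k = 1" by (simp only: assms(2,4) power_one mult_1_left)
  have "w' ^ m * w = 1" by (rule root_of_unity_eq_1[OF in_R root red assms(6)])
  hence "w' ^ m * w = w' ^ m * w'" by (simp only: inverse)
  thus ?thesis using inverse by (metis mult_left_cancel mult_zero_left zero_neq_one)
qed (use assms(6) in simp)

end

lemma complex_subring_hom_range_ipoly:
  fixes g :: "'a :: field"
  assumes red: "\<And>h. red (ipoly h \<eta>) = ipoly h g"
  shows "complex_subring_hom (range (\<lambda>h. ipoly h \<eta>)) red"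
proof
  let ?R = "range (\<lambda>h. ipoly h \<eta>)"
  show "1 \<in> ?R" "red 1 = 1" using red[of 1] by (auto intro: range_eqI[of _ _ 1])
  show "x - y \<in> ?R" "red (x - y) = red x - red y" if "x \<in> ?R" "y \<in> ?R" for x y
    using that by (auto simp: red simp flip: ipoly_diff)
  show "x * y \<in> ?R" "red (x * y) = red x * red y" if "x \<in> ?R" "y \<in> ?R" for x y
    using that by (auto simp: red simp flip: ipoly_mult)
qed

lemma exists_reduction_from_complex_root_of_unity:
  fixes g :: "'a :: idom"
  assumes "CHAR('a) > 1" "N > 0" "g ^ N = 1"
  obtains \<eta> :: complex and red where "(\<eta> ^ N) ^ CHAR('a) = 1" "\<eta> ^ N \<noteq> 1"
    "\<And>h. red (ipoly h \<eta>) = ipoly h g"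
proof -
  \<comment> \<open>\<open>\<Psi>\<close> vanishes at \<open>g\<close>, as \<open>g ^ N = 1\<close>, and at a complex \<open>\<eta>\<close> iff \<open>\<eta> ^ N\<close> has order \<open>CHAR('a)\<close>.\<close>
  define \<Psi> :: "int poly" where "\<Psi> = (\<Sum>i<CHAR('a). [:0, 1:] ^ (N * i))"
  have ipoly_\<Psi>: "ipoly \<Psi> x = (\<Sum>i<CHAR('a). (x ^ N) ^ i)" for x :: "'b :: comm_ring_1"
    by (simp add: \<Psi>_def power_mult)
  have "poly \<Psi> 0 = (\<Sum>i\<in>{0 :: nat}. 1)"
    unfolding \<Psi>_def poly_sum
    using assms by (intro sum.mono_neutral_cong_right) (auto simp: power_0_left)
  hence "content \<Psi> dvd 1" using content_dvd_coeff[of \<Psi> 0] by (simp add: poly_0_coeff_0)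
  hence "content \<Psi> = 1" by (simp only: is_unit_content_iff)
  moreover have "ipoly \<Psi> g = 0" by (simp add: ipoly_\<Psi> assms(3))
  ultimately have "\<exists>(\<eta> :: complex) red. ipoly \<Psi> \<eta> = 0 \<and> (\<forall>h. red (ipoly h \<eta>) = ipoly h g)"
    by (rule exists_reduction_from_complex)
  then obtain \<eta> :: complex and red
    where \<eta>: "ipoly \<Psi> \<eta> = 0" and red: "\<And>h. red (ipoly h \<eta>) = ipoly h g" by blast
  have sum_0: "(\<Sum>i<CHAR('a). (\<eta> ^ N) ^ i) = 0" using \<eta> unfolding ipoly_\<Psi> .
  have "(\<eta> ^ N) ^ CHAR('a) = 1" using sum_0 power_diff_1_eq[of "\<eta> ^ N" "CHAR('a)"] by simp
  moreover have "\<eta> ^ N \<noteq> 1" using sum_0 assms(1) by auto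
  ultimately show ?thesis using red by (rule that)
qed

text \<open>\<open>red\<close> is reduction modulo a prime above \<open>p\<close> in a ring \<open>R\<close> of cyclotomic integers.\<close>

locale cyclotomic_reduction =
  finite_field_of_degree "TYPE('a)" p n + complex_subring_hom R red
  for p n :: nat and R :: "complex set" and red :: "complex \<Rightarrow> 'a :: finite_field" +
  assumes zeta_in [simp, intro]: "zeta p \<in> R"
    and exists_root_of_unity_lift: "u \<noteq> 0 \<Longrightarrow> \<exists>w\<in>R. w ^ (CARD('a) - 1) = 1 \<and> red w = u"

lemma exists_cyclotomic_reduction:
  assumes "finite_field_of_degree TYPE('a :: finite_field) p n"
  obtains R and red :: "complex \<Rightarrow> 'a :: finite_field" where "cyclotomic_reduction p n R red"
proof -
  interpret finite_field_of_degree "TYPE('a)" p n by fact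
  define N where "N = CARD('a) - 1"
  have "N > 0" using CARD_finite_field_gt_1[where 'a = 'a] by (simp add: N_def)
  obtain g :: 'a where g: "g \<noteq> 0" "\<And>x. x \<noteq> 0 \<Longrightarrow> \<exists>i. x = g ^ i"
    using finite_field_has_generator by blast
  have "g ^ N = 1" unfolding N_def by (rule power_CARD_minus_1_eq_1[OF g(1)])
  then obtain \<eta> :: complex and red where \<eta>: "(\<eta> ^ N) ^ p = 1" "\<eta> ^ N \<noteq> 1"
    and red: "\<And>h. red (ipoly h \<eta>) = ipoly h g"
    using exists_reduction_from_complex_root_of_unity[of N g] \<open>N > 0\<close> p_gt_1 CHAR_eq by metis
  define R where "R = range (\<lambda>h. ipoly h \<eta>)"
  have power: "\<eta> ^ k \<in> R" "red (\<eta> ^ k) = g ^ k" for k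
    using red[of "[:0, 1:] ^ k"] unfolding R_def by (auto intro: range_eqI[of _ _ "[:0, 1:] ^ k"])
  interpret complex_subring_hom R red
    unfolding R_def by (rule complex_subring_hom_range_ipoly[OF red])
  have "cyclotomic_reduction p n R red"
  proof
    obtain k where "zeta p = (\<eta> ^ N) ^ k" using zeta_in_powers[OF prime_p \<eta>] by blast
    thus "zeta p \<in> R" using power(1)[of "N * k"] by (simp add: power_mult)
  next
    fix u :: 'a assume "u \<noteq> 0"
    obtain i where i: "u = g ^ i" using g(2)[OF \<open>u \<noteq> 0\<close>] by blast
    obtain m where m: "CARD('a) = p * m" using CHAR_dvd_CARD[where 'a = 'a] by auto
    define w where "w = \<eta> ^ (CARD('a) * i)"
    have "w ^ N = ((\<eta> ^ N) ^ p) ^ (m * i)"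
      unfolding w_def m by (simp add: mult_ac flip: power_mult)
    hence "w ^ N = 1" by (simp add: \<eta>(1))
    moreover have "red w = g ^ (CARD('a) * i)" unfolding w_def by (rule power)
    hence "red w = u" unfolding i power_mult by (simp add: finite_field_power_card_eq_same)
    moreover have "w \<in> R" unfolding w_def by (rule power)
    ultimately show "\<exists>w\<in>R. w ^ (CARD('a) - 1) = 1 \<and> red w = u" unfolding N_def by blast
  qed
  thus ?thesis by (rule that)
qed

section \<open>Teichmueller characters\<close>

context cyclotomic_reduction
begin

definition teichmueller :: "'a \<Rightarrow> complex" where
  "teichmueller u = (if u = 0 then 0 else THE w. w \<in> R \<and> w ^ (CARD('a) - 1) = 1 \<and> red w = u)"

lemma teichmueller_0 [simp]: "teichmueller 0 = 0"
  by (simp add: teichmueller_def)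

lemma teichmueller_eqI:
  assumes "w \<in> R" "w ^ (CARD('a) - 1) = 1" "red w = u" "u \<noteq> 0"
  shows "teichmueller u = w"
proof -
  have unit: "of_nat (CARD('a) - 1) \<noteq> (0 :: 'a)" by (simp only: of_nat_CARD_minus_1) simp
  have "(THE v. v \<in> R \<and> v ^ (CARD('a) - 1) = 1 \<and> red v = u) = w"
  proof (rule the_equality)
    show "w \<in> R \<and> w ^ (CARD('a) - 1) = 1 \<and> red w = u" by (intro conjI assms)
    fix v assume v: "v \<in> R \<and> v ^ (CARD('a) - 1) = 1 \<and> red v = u"
    show "v = w"
      by (rule roots_of_unity_eqI[OF _ _ assms(1,2) _ unit]) (use v assms(3) in simp_all)
  qed
  thus ?thesis using assms(4) by (simp only: teichmueller_def if_False)
qed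

lemma teichmueller_root_of_unity: "u \<noteq> 0 \<Longrightarrow> teichmueller u ^ (CARD('a) - 1) = 1"
  and teichmueller_in [simp, intro]: "teichmueller u \<in> R"
  and red_teichmueller [simp]: "red (teichmueller u) = u"
  using exists_root_of_unity_lift[of u] teichmueller_eqI by (cases "u = 0"; force)+

lemma teichmueller_1 [simp]: "teichmueller 1 = 1"
  by (rule teichmueller_eqI) auto

lemma teichmueller_mult: "teichmueller (u * v) = teichmueller u * teichmueller v"
proof (cases "u = 0 \<or> v = 0")
  case False
  thus ?thesis
    by (intro teichmueller_eqI)
      (auto simp: power_mult_distrib teichmueller_root_of_unity simp del: One_nat_def)
qed auto

lemma teichmueller_power: "teichmueller (u ^ k) = teichmueller u ^ k"
  by (induction k) (simp_all add: teichmueller_mult)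

text \<open>The inverse makes the valuation of the Gauss sum the digit sum of \<open>a\<close>, not of \<open>q - 1 - a\<close>.\<close>

definition teich_char :: "nat \<Rightarrow> 'a \<Rightarrow> complex" where
  "teich_char a x = (if x = 0 then 0 else teichmueller (inverse x) ^ a)"

lemma multiplicative_teich_char: "multiplicative_character (teich_char a)"
  by (simp add: multiplicative_character_def teich_char_def teichmueller_mult power_mult_distrib)

lemma teich_char_in [simp, intro]: "teich_char a x \<in> R"
  by (simp add: teich_char_def)

lemma red_teich_char: "x \<noteq> 0 \<Longrightarrow> red (teich_char a x) = inverse x ^ a"
  by (simp add: teich_char_def)

lemma teich_char_add: "teich_char (a + b) = (\<lambda>x. teich_char a x * teich_char b x)"
  by (simp add: fun_eq_iff teich_char_def power_add)

lemma teich_char_mult: "k > 0 \<Longrightarrow> teich_char (k * a) = (\<lambda>x. teich_char a (x ^ k))"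
  by (simp add: fun_eq_iff teich_char_def power_mult teichmueller_power flip: power_inverse)

lemma teich_char_eq_1: "(CARD('a) - 1) dvd a \<Longrightarrow> x \<noteq> 0 \<Longrightarrow> teich_char a x = 1"
  by (auto elim!: dvdE simp: teich_char_def power_mult teichmueller_root_of_unity
      simp del: One_nat_def)

lemma teich_char_nontrivial:
  assumes "\<not> (CARD('a) - 1) dvd a"
  shows "\<exists>u. u \<noteq> 0 \<and> teich_char a u \<noteq> 1"
proof -
  obtain u :: 'a where u: "u \<noteq> 0" "u ^ a \<noteq> 1" using exists_power_ne_1[OF assms] by blast
  hence "red (teich_char a (inverse u)) \<noteq> red 1" by (simp add: red_teich_char)
  thus ?thesis using u(1) by (intro exI[of _ "inverse u"]) auto
qed

lemma teich_char_inverse: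
  assumes "(CARD('a) - 1) dvd d * a + b" "d > 0" "x \<noteq> 0"
  shows "teich_char b (inverse x) = teich_char a (x ^ d)"
proof -
  have "teich_char b (inverse x) * teich_char b x = 1"
    using assms(3) multiplicative_characterD[OF multiplicative_teich_char] by (metis left_inverse)
  moreover have "teich_char a (x ^ d) * teich_char b x = 1"
    using teich_char_eq_1[OF assms(1,3)] unfolding teich_char_add teich_char_mult[OF assms(2)] .
  ultimately show ?thesis by (metis mult_cancel_right zero_neq_one mult_zero_right)
qed

section \<open>Divisibility of Gauss sums\<close>

abbreviation \<pi> :: complex where "\<pi> \<equiv> 1 - zeta p"

abbreviation gauss :: "nat \<Rightarrow> complex" where "gauss a \<equiv> gauss_sum (teich_char a)"

lemma pi_ne_0: "\<pi> \<noteq> 0"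
  using zeta_ne_1[OF p_gt_1] by simp

lemma red_zeta [simp]: "red (zeta p) = 1"
proof -
  have "(red (zeta p) - 1) ^ p + 1 ^ p = (red (zeta p) - 1 + 1) ^ p"
    by (rule freshmans_dream[symmetric]) (simp_all add: prime_p)
  also have "\<dots> = red (zeta p ^ p)" by simp
  also have "\<dots> = 1" by (simp only: zeta_power_self[OF p_pos] red_1)
  finally show ?thesis by simp
qed

lemma canonical_char_in [simp, intro]: "\<psi> x \<in> R" and red_canonical_char [simp]: "red (\<psi> x) = 1"
  by (simp_all add: canonical_char_eq)

lemma gauss_in [simp, intro]: "gauss a \<in> R"
  unfolding gauss_sum_def by auto

text \<open>Divisibility in the localisation of \<open>R\<close> at the kernel of \<open>red\<close>.\<close>

definition locally_dvd :: "complex \<Rightarrow> complex \<Rightarrow> bool" where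
  "locally_dvd x y \<longleftrightarrow> (\<exists>u\<in>R. \<exists>r\<in>R. red u \<noteq> 0 \<and> u * y = r * x)"

lemma locally_dvdI: "u \<in> R \<Longrightarrow> r \<in> R \<Longrightarrow> red u \<noteq> 0 \<Longrightarrow> u * y = r * x \<Longrightarrow> locally_dvd x y"
  unfolding locally_dvd_def by blast

lemma locally_dvdE:
  assumes "locally_dvd x y"
  obtains u r where "u \<in> R" "r \<in> R" "red u \<noteq> 0" "u * y = r * x"
  using assms unfolding locally_dvd_def by blast

lemma locally_dvd_mult:
  assumes "locally_dvd x y" "locally_dvd x' y'"
  shows "locally_dvd (x * x') (y * y')"
proof -
  obtain u r where u: "u \<in> R" "r \<in> R" "red u \<noteq> 0" "u * y = r * x"
    using assms(1) by (rule locally_dvdE)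
  obtain v s where v: "v \<in> R" "s \<in> R" "red v \<noteq> 0" "v * y' = s * x'"
    using assms(2) by (rule locally_dvdE)
  show ?thesis
  proof (rule locally_dvdI)
    have "u * v * (y * y') = (u * y) * (v * y')" by simp
    thus "u * v * (y * y') = r * s * (x * x')" by (simp add: u(4) v(4))
  qed (use u v in auto)
qed

lemma locally_dvd_trans:
  assumes "locally_dvd x y" "locally_dvd y z"
  shows "locally_dvd x z"
proof -
  obtain u r where u: "u \<in> R" "r \<in> R" "red u \<noteq> 0" "u * y = r * x"
    using assms(1) by (rule locally_dvdE)
  obtain v s where v: "v \<in> R" "s \<in> R" "red v \<noteq> 0" "v * z = s * y"
    using assms(2) by (rule locally_dvdE)
  show ?thesis
  proof (rule locally_dvdI)
    have "v * u * z = u * (v * z)" by simp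
    also have "\<dots> = s * (u * y)" by (simp add: v(4))
    finally show "v * u * z = s * r * x" by (simp add: u(4))
  qed (use u v in auto)
qed

lemma red_gauss_trivial:
  assumes "(CARD('a) - 1) dvd a"
  shows "red (gauss a) = - 1"
proof -
  have "red (gauss a) = (\<Sum>x\<in>UNIV. red (teich_char a x))"
    unfolding gauss_sum_def by (subst red_sum) auto
  also have "\<dots> = (\<Sum>x\<in>UNIV - {0 :: 'a}. 1)"
    using assms
    by (intro sum.mono_neutral_cong_right) (auto simp: teich_char_eq_1, simp add: teich_char_def)
  also have "\<dots> = of_nat (CARD('a) - 1)" by (simp add: card_Diff_subset)
  finally show ?thesis by (simp only: of_nat_CARD_minus_1)
qed

lemma gauss_add_locally_dvd: "locally_dvd (gauss (a + b)) (gauss a * gauss b)"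
proof (cases "(CARD('a) - 1) dvd a + b")
  case True
  thus ?thesis
    by (intro locally_dvdI[of "gauss (a + b)" "gauss a * gauss b"]) (auto simp: red_gauss_trivial)
next
  case False
  obtain u where "u \<noteq> 0" "teich_char (a + b) u \<noteq> 1" using teich_char_nontrivial[OF False] by metis
  hence "gauss a * gauss b = jacobi_sum (teich_char a) (teich_char b) * gauss (a + b)"
    unfolding teich_char_add
    by (rule gauss_sum_mult[OF multiplicative_teich_char multiplicative_teich_char])
  moreover have "jacobi_sum (teich_char a) (teich_char b) \<in> R" unfolding jacobi_sum_def by auto
  ultimately show ?thesis by (intro locally_dvdI[of 1]) auto
qed

lemma gauss_mult_CHAR_power: "gauss (p ^ i * a) = gauss a"
proof (induction i)
  case (Suc i)
  have "gauss (p * (p ^ i * a)) = gauss (p ^ i * a)"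
    unfolding teich_char_mult[OF p_pos] by (rule gauss_sum_power_CHAR)
  thus ?case using Suc by (simp add: mult.assoc)
qed simp

lemma gauss_1_locally_dvd_pi:
  assumes "CARD('a) > 2"
  shows "locally_dvd (gauss 1) \<pi>"
proof -
  define E where "E = (\<lambda>x :: 'a. \<Sum>j<trace_rep x. zeta p ^ j)"
  have E: "E x \<in> R" "red (E x) = abs_trace x" for x
    by (auto simp: E_def red_sum of_nat_trace_rep)
  have char: "\<psi> x = 1 - \<pi> * E x" for x
    using power_diff_1_eq[of "zeta p" "trace_rep x"]
    by (simp add: E_def canonical_char_eq algebra_simps)
  define S where "S = (\<Sum>x\<in>UNIV. teich_char 1 x * E x)"
  have "S \<in> R" unfolding S_def using E(1) by auto
  have "\<not> (CARD('a) - 1) dvd 1" using assms by simp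
  then obtain u where "u \<noteq> 0" "teich_char 1 u \<noteq> 1" using teich_char_nontrivial by blast
  hence "(\<Sum>x\<in>UNIV. teich_char 1 x) = 0"
    using multiplicative_characterD[OF multiplicative_teich_char] by (intro sum_multiplicative_eq_0)
  moreover have "gauss 1 = (\<Sum>x\<in>UNIV. teich_char 1 x - \<pi> * (teich_char 1 x * E x))"
    unfolding gauss_sum_def char by (simp only: right_diff_distrib mult_1_right mult.left_commute)
  ultimately have "gauss 1 = - S * \<pi>"
    by (simp add: S_def sum_subtractf mult.commute flip: sum_distrib_left)
  moreover have "red (teich_char 1 x) = inverse x" for x
    by (cases "x = 0") (simp_all add: red_teich_char, simp add: teich_char_def)
  hence "red S = - 1" using E unfolding S_def by (simp add: red_sum sum_inverse_mult_abs_trace)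
  ultimately show ?thesis using \<open>S \<in> R\<close> by (intro locally_dvdI[of "- S" 1]) auto
qed

lemma gauss_0_locally_dvd_1: "locally_dvd (gauss 0) 1"
  by (rule locally_dvdI[of "gauss 0" 1]) (auto simp: red_gauss_trivial)

lemma gauss_mult_locally_dvd:
  assumes "locally_dvd (gauss a) x"
  shows "locally_dvd (gauss (c * a)) (x ^ c)"
proof (induction c)
  case (Suc c)
  show ?case
    using locally_dvd_trans[OF gauss_add_locally_dvd locally_dvd_mult[OF assms Suc]] by simp
qed (simp add: gauss_0_locally_dvd_1)

lemma gauss_digits_locally_dvd:
  assumes "CARD('a) > 2"
  shows "locally_dvd (gauss (\<Sum>i<m. c i * p ^ i)) (\<pi> ^ (\<Sum>i<m. c i))"
proof (induction m)
  case (Suc m)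
  have "locally_dvd (gauss (p ^ m)) \<pi>"
    using gauss_1_locally_dvd_pi[OF assms] gauss_mult_CHAR_power[of m 1] by simp
  from locally_dvd_mult[OF Suc gauss_mult_locally_dvd[OF this, of "c m"]]
  show ?case using locally_dvd_trans[OF gauss_add_locally_dvd] by (simp add: power_add)
qed (simp add: gauss_0_locally_dvd_1)

lemma exists_weil_sum_not_divisible:
  assumes d: "coprime d (CARD('a) - 1)" "d > 0"
    and ab: "(CARD('a) - 1) dvd d * a + b" "\<not> (CARD('a) - 1) dvd b"
    and dvd: "locally_dvd (gauss a * gauss b) (\<pi> ^ K)"
  shows "\<exists>c :: 'a. \<forall>r\<in>R. weil_sum d c \<noteq> \<pi> ^ Suc K * r"
proof (rule ccontr)
  assume "\<not> ?thesis"
  then obtain r where r: "\<And>c :: 'a. r c \<in> R" "\<And>c. weil_sum d c = \<pi> ^ Suc K * r c" by metis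
  define S where "S = (\<Sum>c\<in>UNIV. teich_char b c * r c)"
  have "S \<in> R" unfolding S_def using r(1) by auto
  obtain t where "t \<noteq> 0" "teich_char b t \<noteq> 1" using teich_char_nontrivial[OF ab(2)] by blast
  hence "teich_char b (- 1) * gauss b * gauss a = (\<Sum>c\<in>UNIV. teich_char b c * weil_sum d c)"
    using d teich_char_inverse[OF ab(1) d(2)]
    by (intro sum_character_mult_weil_sum[symmetric] multiplicative_teich_char)
  also have "\<dots> = \<pi> ^ Suc K * S" unfolding r(2) S_def by (simp add: sum_distrib_left mult_ac)
  finally have transform: "teich_char b (- 1) * gauss b * gauss a = \<pi> ^ Suc K * S" .
  obtain u s where us: "u \<in> R" "s \<in> R" "red u \<noteq> 0" "u * \<pi> ^ K = s * (gauss a * gauss b)"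
    using dvd by (rule locally_dvdE)
  have "u * teich_char b (- 1) * \<pi> ^ K = s * (teich_char b (- 1) * gauss b * gauss a)"
    using us(4) by (simp add: mult_ac)
  also have "\<dots> = \<pi> * (s * S) * \<pi> ^ K" unfolding transform by simp
  finally have "u * teich_char b (- 1) = \<pi> * (s * S)" using pi_ne_0 by simp
  hence "red u * red (teich_char b (- 1)) = red (\<pi> * (s * S))" using us(1) by (simp flip: red_mult)
  thus False using us \<open>S \<in> R\<close> by (simp add: red_teich_char)
qed

section \<open>The valuation of Weil sums\<close>

lemma cyclotomic_ints_in: "z \<in> cyclotomic_ints p \<Longrightarrow> z \<in> R"
  by (auto simp: cyclotomic_ints_def ipoly_in)

lemma cyclotomic_ints_ipoly: "ipoly h (zeta p) \<in> cyclotomic_ints p"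
  by (simp add: cyclotomic_ints_def)

lemma of_nat_p_eq_pi_mult: "\<exists>h. of_nat p = \<pi> * ipoly h (zeta p)"
proof
  have "(zeta p - 1) * (\<Sum>i<p. zeta p ^ i) = 0"
    using power_diff_1_eq[of "zeta p" p] zeta_power_self[OF p_pos] by simp
  hence "(\<Sum>i<p. zeta p ^ i) = 0" using pi_ne_0 by auto
  hence "of_nat p = (\<Sum>i<p. 1 - zeta p ^ i)" by (simp add: sum_subtractf)
  also have "\<dots> = (\<Sum>i<p. \<pi> * (\<Sum>j<i. zeta p ^ j))"
    by (intro sum.cong refl) (simp add: one_diff_power_eq)
  also have "\<dots> = \<pi> * ipoly (\<Sum>i<p. \<Sum>j<i. [:0, 1:] ^ j) (zeta p)"
    by (simp add: sum_distrib_left)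
  finally show "of_nat p = \<pi> * ipoly (\<Sum>i<p. \<Sum>j<i. [:0, 1:] ^ j) (zeta p)" .
qed

lemma red_eq_0_imp_pi_dvd:
  assumes "z \<in> cyclotomic_ints p" "red z = 0"
  shows "\<exists>u\<in>cyclotomic_ints p. z = \<pi> * u"
proof -
  obtain h where h: "z = ipoly h (zeta p)" using assms(1) by (auto simp: cyclotomic_ints_def)
  have "ipoly h (1 :: 'a) = of_int (poly h 1)" by (induction h) simp_all
  hence "of_int (poly h 1) = (0 :: 'a)" using assms(2) by (simp add: h red_ipoly)
  hence "int p dvd poly h 1" using of_int_eq_0_iff_char_dvd[where 'a = 'a] by simp
  then obtain c where c: "poly h 1 = int p * c" by blast
  obtain w where w: "of_nat p = \<pi> * ipoly w (zeta p)" using of_nat_p_eq_pi_mult by blast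
  have "poly (h - [:poly h 1:]) 1 = 0" by simp
  then obtain k where "h - [:poly h 1:] = [:- 1, 1:] * k" unfolding poly_eq_0_iff_dvd by blast
  hence "ipoly (h - [:poly h 1:]) (zeta p) = ipoly ([:- 1, 1:] * k) (zeta p)" by (simp only:)
  hence "z = of_nat p * of_int c - \<pi> * ipoly k (zeta p)" by (simp add: h c algebra_simps)
  also have "\<dots> = \<pi> * ipoly (smult c w - k) (zeta p)" unfolding w by (simp add: algebra_simps)
  finally show ?thesis using cyclotomic_ints_ipoly by blast
qed

lemma prime_to_p_iff: "z \<in> prime_to_p p \<longleftrightarrow> z \<in> cyclotomic_ints p \<and> red z \<noteq> 0"
proof
  assume "z \<in> prime_to_p p"
  thus "z \<in> cyclotomic_ints p \<and> red z \<noteq> 0"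
    using red_eq_0_imp_pi_dvd[of z] by (auto simp: prime_to_p_def)
next
  assume "z \<in> cyclotomic_ints p \<and> red z \<noteq> 0"
  moreover have "red (\<pi> * u) = 0" if "u \<in> cyclotomic_ints p" for u
    using cyclotomic_ints_in[OF that] by simp
  ultimately show "z \<in> prime_to_p p" by (auto simp: prime_to_p_def)
qed

lemma pi_exponent_le:
  assumes "a \<in> prime_to_p p" "b \<in> prime_to_p p" "a' \<in> prime_to_p p" "b' \<in> prime_to_p p"
    and eq: "\<pi> powi k * a / b = \<pi> powi k' * a' / b'"
  shows "k' \<le> k"
proof (rule ccontr)
  assume "\<not> k' \<le> k"
  then obtain m where m: "k' = k + int (Suc m)" by (metis not_le zless_iff_Suc_zadd)
  have R: "a \<in> R" "b \<in> R" "a' \<in> R" "b' \<in> R" and red: "red a \<noteq> 0" "red b \<noteq> 0" "red b' \<noteq> 0"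
    using assms(1-4) cyclotomic_ints_in by (auto simp: prime_to_p_iff)
  hence "b \<noteq> 0" "b' \<noteq> 0" by auto
  hence "\<pi> powi k * a * b' = \<pi> powi k' * a' * b" using eq by (simp add: frac_eq_eq)
  moreover have "\<pi> powi k' = \<pi> powi k * \<pi> ^ Suc m"
    unfolding m by (subst power_int_add) (use pi_ne_0 in \<open>auto simp only: power_int_of_nat\<close>)
  ultimately have "\<pi> powi k * (a * b') = \<pi> powi k * (\<pi> * (\<pi> ^ m * a' * b))"
    by (simp only: mult_ac power_Suc)
  hence "a * b' = \<pi> * (\<pi> ^ m * a' * b)" using pi_ne_0 by simp
  hence "red (a * b') = red \<pi> * red (\<pi> ^ m * a' * b)" using R by simp
  thus False using R red by simp
qed

lemma val_p_pi_power_mult: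
  assumes "a \<in> prime_to_p p"
  shows "val_p p (\<pi> ^ k * a) = ereal (real k / (real p - 1))"
proof -
  have one: "1 \<in> prime_to_p p" using cyclotomic_ints_ipoly[of 1] by (simp add: prime_to_p_iff)
  have "(THE j :: int. \<exists>a'\<in>prime_to_p p. \<exists>b'\<in>prime_to_p p. \<pi> ^ k * a = \<pi> powi j * a' / b') = int k"
  proof (rule the_equality)
    show "\<exists>a'\<in>prime_to_p p. \<exists>b'\<in>prime_to_p p. \<pi> ^ k * a = \<pi> powi (int k) * a' / b'"
      using assms one by (intro bexI[of _ a] bexI[of _ 1]) simp_all
    fix j assume "\<exists>a'\<in>prime_to_p p. \<exists>b'\<in>prime_to_p p. \<pi> ^ k * a = \<pi> powi j * a' / b'"
    then obtain a' b' where ab: "a' \<in> prime_to_p p" "b' \<in> prime_to_p p"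
      and "\<pi> ^ k * a = \<pi> powi j * a' / b'" by blast
    hence eq: "\<pi> powi (int k) * a / 1 = \<pi> powi j * a' / b'" by simp
    show "j = int k"
      using pi_exponent_le[OF assms one ab eq] pi_exponent_le[OF ab assms one eq[symmetric]] by simp
  qed
  moreover have "a \<noteq> 0" using assms by (auto simp: prime_to_p_iff)
  ultimately show ?thesis using pi_ne_0 by (simp add: val_p_def)
qed

lemma exists_pi_power_factorization:
  assumes "z \<in> cyclotomic_ints p" "\<forall>r\<in>R. z \<noteq> \<pi> ^ Suc K * r"
  shows "\<exists>k\<le>K. \<exists>a\<in>prime_to_p p. z = \<pi> ^ k * a"
  using assms
proof (induction K arbitrary: z)
  case 0
  hence "red z \<noteq> 0" using red_eq_0_imp_pi_dvd[of z] cyclotomic_ints_in by auto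
  thus ?case using 0 by (auto simp: prime_to_p_iff)
next
  case (Suc K)
  show ?case
  proof (cases "red z = 0")
    case True
    then obtain u where u: "u \<in> cyclotomic_ints p" "z = \<pi> * u"
      using red_eq_0_imp_pi_dvd Suc.prems(1) by blast
    have "\<forall>r\<in>R. u \<noteq> \<pi> ^ Suc K * r" using Suc.prems(2) by (auto simp: u(2) mult.assoc)
    then obtain k a where "k \<le> K" "a \<in> prime_to_p p" "u = \<pi> ^ k * a" using Suc.IH[OF u(1)] by blast
    thus ?thesis using u(2) by (intro exI[of _ "Suc k"] conjI bexI[of _ a]) auto
  next
    case False
    thus ?thesis
      using Suc.prems(1) by (intro exI[of _ 0] conjI bexI[of _ z]) (auto simp: prime_to_p_iff)
  qed
qed

lemma val_p_le:
  assumes "z \<in> cyclotomic_ints p" "\<forall>r\<in>R. z \<noteq> \<pi> ^ Suc K * r"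
  shows "val_p p z \<le> ereal (real K / (real p - 1))"
proof -
  obtain k a where k: "k \<le> K" and "a \<in> prime_to_p p" "z = \<pi> ^ k * a"
    using exists_pi_power_factorization[OF assms] by blast
  hence "val_p p z = ereal (real k / (real p - 1))" by (simp only: val_p_pi_power_mult)
  moreover have "real k / (real p - 1) \<le> real K / (real p - 1)"
    using k p_gt_1 by (intro divide_right_mono) auto
  ultimately show ?thesis by simp
qed

lemma weil_sum_in_cyclotomic_ints: "weil_sum d (c :: 'a) \<in> cyclotomic_ints p"
proof -
  have "weil_sum d c = ipoly (\<Sum>x\<in>UNIV. [:0, 1:] ^ trace_rep (x ^ d - c * x)) (zeta p)"
    by (simp add: weil_sum_def canonical_char_eq)
  thus ?thesis by (simp only: cyclotomic_ints_ipoly)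
qed

lemma weil_val_le_digit_sum:
  assumes d: "coprime d (CARD('a) - 1)" "d > 0"
    and ab: "(CARD('a) - 1) dvd d * (\<Sum>i<m. a i * p ^ i) + (\<Sum>i<m. b i * p ^ i)"
      "\<not> (CARD('a) - 1) dvd (\<Sum>i<m. a i * p ^ i)"
  shows "weil_val TYPE('a) d \<le> ereal (real (\<Sum>i<m. a i + b i) / (real p - 1))"
proof -
  have "CARD('a) \<noteq> 2" using ab(2) by auto
  hence "CARD('a) > 2" using CARD_finite_field_gt_1[where 'a = 'a] by linarith
  from locally_dvd_mult[OF gauss_digits_locally_dvd[OF this] gauss_digits_locally_dvd[OF this]]
  have dvd: "locally_dvd (gauss (\<Sum>i<m. a i * p ^ i) * gauss (\<Sum>i<m. b i * p ^ i))
      (\<pi> ^ (\<Sum>i<m. a i + b i))"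
    by (simp add: power_add sum.distrib)
  have "\<not> (CARD('a) - 1) dvd (\<Sum>i<m. b i * p ^ i)"
    using ab d(1) by (metis coprime_commute coprime_dvd_mult_right_iff dvd_add_left_iff)
  then obtain c :: 'a where "\<forall>r\<in>R. weil_sum d c \<noteq> \<pi> ^ Suc (\<Sum>i<m. a i + b i) * r"
    using exists_weil_sum_not_divisible[OF d ab(1) _ dvd] by blast
  from val_p_le[OF weil_sum_in_cyclotomic_ints this]
  have "val_p p (weil_sum d c) \<le> ereal (real (\<Sum>i<m. a i + b i) / (real p - 1))" .
  moreover have "weil_val TYPE('a) d \<le> val_p p (weil_sum d c)"
    unfolding weil_val_def CHAR_eq by (intro Min_le) auto
  ultimately show ?thesis by (rule order_trans[rotated])
qed

end

section \<open>Periodic digit sequences of small weight\<close>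

definition digit_weight_le :: "nat \<Rightarrow> nat \<Rightarrow> nat \<Rightarrow> nat \<Rightarrow> bool" where
  "digit_weight_le p s d w \<longleftrightarrow> (\<exists>a b :: nat \<Rightarrow> nat.
     (p ^ s - 1) dvd d * (\<Sum>i<s. a i * p ^ i) + (\<Sum>i<s. b i * p ^ i) \<and>
     \<not> (p ^ s - 1) dvd (\<Sum>i<s. a i * p ^ i) \<and> (\<Sum>i<s. a i + b i) \<le> w)"

lemma digit_weight_le_mono: "digit_weight_le p s d w \<Longrightarrow> w \<le> w' \<Longrightarrow> digit_weight_le p s d w'"
  unfolding digit_weight_le_def by (elim ex_forward conj_forward; simp)

lemma digit_weight_le_one_digit:
  assumes "(p - 1) dvd d * k + l" "\<not> (p - 1) dvd k" "k + l \<le> w"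
  shows "digit_weight_le p 1 d w"
  unfolding digit_weight_le_def
  by (rule exI[of _ "\<lambda>_. k"], rule exI[of _ "\<lambda>_. l"]) (use assms in simp)

lemma digit_weight_le_two_digits:
  assumes "(p\<^sup>2 - 1) dvd d * (a\<^sub>0 + a\<^sub>1 * p) + (b\<^sub>0 + b\<^sub>1 * p)" "\<not> (p\<^sup>2 - 1) dvd a\<^sub>0 + a\<^sub>1 * p"
    and "a\<^sub>0 + a\<^sub>1 + b\<^sub>0 + b\<^sub>1 \<le> w"
  shows "digit_weight_le p 2 d w"
  unfolding digit_weight_le_def
  by (rule exI[of _ "\<lambda>i. if i = 0 then a\<^sub>0 else a\<^sub>1"],
      rule exI[of _ "\<lambda>i. if i = 0 then b\<^sub>0 else b\<^sub>1"])
    (use assms in \<open>simp add: numeral_2_eq_2\<close>)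

subsection \<open>The generic exponents: constant digits\<close>

lemma lattice_basis_sum_height_le:
  fixes x y t\<^sub>1 t\<^sub>2 :: int
  assumes "t\<^sub>1 \<ge> 1" "t\<^sub>2 \<ge> 0" "y \<ge> 1" "x \<ge> 3" "x > 2 * t\<^sub>2"
  shows "3 * (t\<^sub>1 + t\<^sub>2) \<le> t\<^sub>1 * x + t\<^sub>2 * y + 2"
proof -
  have "t\<^sub>1 * (x - 3) \<ge> 1 * (x - 3)" using assms by (intro mult_right_mono) auto
  moreover have "x - 3 + t\<^sub>2 * (y - 3) \<ge> - 2"
  proof -
    consider "y = 1" | "y = 2" | "y \<ge> 3" using assms by linarith
    thus ?thesis
    proof cases
      case 3
      hence "t\<^sub>2 * (y - 3) \<ge> 0" using assms by simp
      thus ?thesis using assms by linarith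
    qed (use assms in auto)
  qed
  ultimately show ?thesis by (simp add: algebra_simps)
qed

text \<open>A subtractive Euclidean algorithm on the lattice of pairs \<open>(t, k)\<close> with \<open>k \<equiv> c * t\<close> modulo
  \<open>M\<close>: of the basis \<open>(t\<^sub>1, - y)\<close>, \<open>(t\<^sub>2, x)\<close> the first vector lies below the cone \<open>0 \<le> k \<le> 2 * t\<close> and
  the second above it; their sum replaces one of the two until it falls into the cone.\<close>

lemma lattice_descent:
  fixes M c :: int
  assumes "t\<^sub>1 \<ge> 1" "t\<^sub>2 \<ge> 0" "y \<ge> 1" "x \<ge> 3" "x > 2 * t\<^sub>2" "t\<^sub>1 * x + t\<^sub>2 * y = M"
    and "[c * t\<^sub>1 = - y] (mod M)" "[c * t\<^sub>2 = x] (mod M)"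
  shows "\<exists>t\<ge>1. 3 * t \<le> M + 2 \<and> c * t mod M \<le> 2 * t"
  using assms
proof (induction "nat (x + y)" arbitrary: t\<^sub>1 t\<^sub>2 x y rule: less_induct)
  case less
  note basis = less.prems
  have sum: "[c * (t\<^sub>1 + t\<^sub>2) = x - y] (mod M)"
    using cong_add[OF basis(7,8)] by (simp add: algebra_simps)
  consider (below) "x < y" | (inside) "y \<le> x" "x - y \<le> 2 * (t\<^sub>1 + t\<^sub>2)"
    | (above) "x - y > 2 * (t\<^sub>1 + t\<^sub>2)"
    using basis by linarith
  thus ?case
  proof cases
    case below
    show ?thesis
    proof (rule less.hyps[of x "y - x" "t\<^sub>1 + t\<^sub>2" t\<^sub>2])
      show "[c * (t\<^sub>1 + t\<^sub>2) = - (y - x)] (mod M)" using sum by simp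
    qed (use basis below in \<open>auto simp: algebra_simps\<close>)
  next
    case inside
    have "0 < M" using basis by (auto intro!: add_pos_nonneg simp flip: basis(6))
    have "c * (t\<^sub>1 + t\<^sub>2) mod M = (x - y) mod M" using sum by (simp add: cong_def)
    also have "\<dots> \<le> x - y" using inside \<open>0 < M\<close> by (intro zmod_le_nonneg_dividend) auto
    finally have "c * (t\<^sub>1 + t\<^sub>2) mod M \<le> 2 * (t\<^sub>1 + t\<^sub>2)" using inside by linarith
    thus ?thesis
      using basis lattice_basis_sum_height_le[OF basis(1-5)] by (intro exI[of _ "t\<^sub>1 + t\<^sub>2"]) auto
  next
    case above
    show ?thesis
      by (rule less.hyps[of "x - y" y t\<^sub>1 "t\<^sub>1 + t\<^sub>2"])
        (use basis above sum in \<open>auto simp: algebra_simps\<close>)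
  qed
qed

lemma exists_multiple_with_residue_le_double:
  fixes M c :: int
  assumes "M \<ge> 3"
  shows "\<exists>t\<ge>1. 3 * t \<le> M + 2 \<and> c * t mod M \<le> 2 * t"
proof (rule lattice_descent[of 1 0 "M - c mod M" M])
  show "M - c mod M \<ge> 1" using assms pos_mod_bound[of M c] by linarith
  show "[c * 1 = - (M - c mod M)] (mod M)" by (simp add: cong_def)
  show "[c * 0 = M] (mod M)" by (simp add: cong_def)
qed (use assms in auto)

lemma exists_multiple_with_small_residue:
  fixes g M c :: int
  assumes "M \<ge> 3" "g > 0" "even g" "g * M mod 3 \<noteq> 2"
  shows "\<exists>t\<ge>1. 3 * (g * t) \<le> g * M + 2 \<and> c * t mod M \<le> g * t"
proof (cases "g = 2")
  case True
  obtain t where t: "t \<ge> 1" "3 * t \<le> M + 2" "c * t mod M \<le> 2 * t"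
    using exists_multiple_with_residue_le_double[OF assms(1)] by blast
  have "3 * t \<le> M + 1" using t(2) assms(4) unfolding True by presburger
  thus ?thesis using t True by (intro exI[of _ t]) auto
next
  case False
  define t where "t = M div 3"
  have t: "t \<ge> 1" "3 * t \<le> M" "M - 1 \<le> 4 * t" using assms(1) unfolding t_def by presburger+
  have "g \<ge> 4" using assms(2,3) False by presburger
  hence "4 * t \<le> g * t" using t by simp
  moreover have "c * t mod M < M" using assms(1) by simp
  moreover have "g * (3 * t) \<le> g * M" using t assms(2) by simp
  ultimately show ?thesis using t by (intro exI[of _ t] conjI) linarith+
qed

lemma gcd_cofactor_ge_3:
  fixes m a :: int
  assumes "m > 0" "even m" "\<not> m dvd a" "\<not> m dvd a - m div 2"
  obtains M where "m = gcd a m * M" "M \<ge> 3"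
proof -
  define g where "g = gcd a m"
  have "g > 0" using assms(1) by (simp add: g_def)
  obtain M where M: "m = g * M" unfolding g_def by (metis gcd_dvd2 dvdE)
  obtain f where f: "a = g * f" unfolding g_def by (metis gcd_dvd1 dvdE)
  have "M > 0" using M assms(1) \<open>g > 0\<close> by (simp add: zero_less_mult_iff)
  moreover have "M \<noteq> 1" using assms(3) M f by auto
  moreover have "M \<noteq> 2"
  proof
    assume "M = 2"
    hence m: "m = g * 2" using M by simp
    have "odd f" using assms(3) f m by auto
    then obtain f' where "f = 2 * f' + 1" by (metis oddE)
    hence "a - m div 2 = m * f'" using f m by (simp add: algebra_simps)
    thus False using assms(4) by simp
  qed
  ultimately have "M \<ge> 3" by linarith
  thus ?thesis by (rule that[OF M[unfolded g_def]])
qed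

lemma exists_small_weight_pair:
  fixes m d :: int
  assumes m: "m > 0" "even m" "m mod 3 \<noteq> 2" and d: "odd d"
    and "\<not> m dvd 1 - d" "\<not> m dvd 1 - d - m div 2"
  shows "\<exists>k l. k \<ge> 0 \<and> l \<ge> 0 \<and> 3 * (k + l) \<le> m + 2 \<and> m dvd d * k + l \<and> \<not> m dvd k"
proof -
  define g where "g = gcd (1 - d) m"
  have g: "g > 0" "even g" using m d by (auto simp: g_def)
  obtain M where M: "m = g * M" "M \<ge> 3"
    unfolding g_def using gcd_cofactor_ge_3 m assms(5,6) by blast
  obtain c v where bezout: "c * (1 - d) + v * m = g"
    using bezout_int[of "1 - d" m] unfolding g_def by blast
  obtain t where t: "t \<ge> 1" "3 * (g * t) \<le> g * M + 2" "c * t mod M \<le> g * t"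
    using exists_multiple_with_small_residue[OF M(2) g] m(3) M(1) by blast
  \<comment> \<open>\<open>d * k + l = (k + l) - (1 - d) * k\<close>, and \<open>(1 - d) * c \<equiv> g\<close> modulo \<open>m\<close>\<close>
  define k where "k = c * t mod M"
  have k: "0 \<le> k" "k < M" "k \<le> g * t" using M(2) t(3) by (auto simp: k_def)
  have "g * M dvd (1 - d) * (c * t - k)"
    by (intro mult_dvd_mono) (auto simp: k_def g_def minus_mod_eq_mult_div)
  moreover have "d * k + (g * t - k) = (1 - d) * (c * t - k) + m * (v * t)"
    by (simp add: algebra_simps flip: bezout)
  ultimately have dvd: "m dvd d * k + (g * t - k)" using M(1) by simp
  have "\<not> m dvd k"
  proof
    assume "m dvd k"
    moreover have "M \<le> m" using M g(1) by simp
    ultimately have "k = 0" using k zdvd_not_zless[of k m] by fastforce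
    hence "m dvd g * t" using dvd by simp
    moreover have "2 * 3 \<le> m" unfolding M(1) using g M(2) by (intro mult_mono) presburger+
    hence "g * t < m" using t(2) M(1) by linarith
    moreover have "0 < g * t" using t(1) g(1) by simp
    ultimately show False using zdvd_not_zless by blast
  qed
  thus ?thesis using k t dvd M(1) by (intro exI[of _ k] exI[of _ "g * t - k"]) auto
qed

lemma nontrivial_exponent_bounds:
  fixes p d :: nat
  assumes "prime p" "coprime d (p - 1)" "\<not> [d = 1] (mod (p - 1))"
  shows "p \<ge> 5" "odd p" "odd d"
proof -
  have "p \<noteq> 2" using assms(3) by auto
  thus "odd p" using prime_odd_nat[OF assms(1)] prime_ge_2_nat[OF assms(1)] by simp
  thus "odd d" using coprime_common_divisor[OF assms(2), of 2] by auto
  have "p \<noteq> 3" using \<open>odd d\<close> assms(3) by (auto simp: cong_def odd_iff_mod_2_eq_one)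
  thus "p \<ge> 5" using \<open>odd p\<close> \<open>p \<noteq> 2\<close> prime_ge_2_nat[OF assms(1)] by presburger
qed

lemma digit_weight_le_generic:
  fixes p d :: nat
  assumes p: "prime p" and d: "coprime d (p - 1)" "\<not> [d = 1] (mod (p - 1))"
    and generic: "\<not> [d = (p + 1) div 2] (mod (p - 1))"
  shows "digit_weight_le p 1 d ((p + 1) div 3)"
proof -
  note bounds = nontrivial_exponent_bounds[OF p d]
  define m where "m = int (p - 1)"
  have m: "m = int p - 1" using bounds by (simp add: m_def)
  have not_dvd: "\<not> m dvd int e - int d" if "\<not> [d = e] (mod (p - 1))" for e
    using that unfolding m_def by (metis cong_iff_dvd_diff cong_int_iff cong_sym)
  have "\<not> 3 dvd p" using primes_dvd_imp_eq[of 3 p] p bounds by auto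
  have "\<exists>k l. k \<ge> 0 \<and> l \<ge> 0 \<and> 3 * (k + l) \<le> m + 2 \<and> m dvd int d * k + l \<and> \<not> m dvd k"
  proof (rule exists_small_weight_pair)
    show "m mod 3 \<noteq> 2" using \<open>\<not> 3 dvd p\<close> unfolding m by presburger
    show "\<not> m dvd 1 - int d" using not_dvd[OF d(2)] by simp
    have half: "int ((p + 1) div 2) = 1 + m div 2" using bounds(2) unfolding m by presburger
    show "\<not> m dvd 1 - int d - m div 2"
    proof
      assume "m dvd 1 - int d - m div 2"
      moreover have "m = 2 * (m div 2)" using bounds(2) by (simp add: m)
      ultimately have "m dvd (1 - int d - m div 2) + 2 * (m div 2)" by (metis dvd_add dvd_refl)
      thus False using not_dvd[OF generic] unfolding half by (simp add: algebra_simps)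
    qed
  qed (use bounds in \<open>auto simp: m\<close>)
  then obtain k l where weight: "3 * (int k + int l) \<le> m + 2"
    and "m dvd int d * int k + int l" "\<not> m dvd int k"
    by (metis zero_le_imp_eq_int)
  moreover have "k + l \<le> (p + 1) div 3" using weight unfolding m by presburger
  ultimately show ?thesis
    by (intro digit_weight_le_one_digit[of p d k l])
      (simp_all add: m_def flip: of_nat_mult of_nat_add)
qed

subsection \<open>The exponents congruent to \<open>(p + 1) div 2\<close> modulo \<open>p - 1\<close>\<close>

lemma exceptional_exponent_imp_cong_1_mod_4:
  fixes p d :: nat
  assumes "odd p" "odd d" "[d = (p + 1) div 2] (mod (p - 1))"
  shows "[p = 1] (mod 4)"
proof -
  have "2 dvd p - 1" using assms(1) by simp
  hence "[d = (p + 1) div 2] (mod 2)" using assms(3) cong_dvd_modulus_nat by blast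
  hence "odd ((p + 1) div 2)" using assms(2) by (auto simp: cong_def odd_iff_mod_2_eq_one)
  thus ?thesis using assms(1) unfolding cong_def by presburger
qed

lemma dvd_mult_add_if_cong:
  fixes d e x y m :: nat
  assumes "m dvd d + e" "[e * x = y] (mod m)"
  shows "m dvd d * x + y"
proof -
  have "[d * x + y = d * x + e * x] (mod m)" using cong_add[OF cong_refl cong_sym[OF assms(2)]] .
  moreover have "m dvd d * x + e * x" using assms(1) by (simp flip: distrib_right)
  ultimately show ?thesis by (simp add: cong_dvd_iff)
qed

lemma digit_weight_le_exceptional:
  fixes p d :: nat
  assumes "p \<ge> 5" "odd p" "[d = (p + 1) div 2] (mod (p - 1))"
  shows "digit_weight_le p 1 d ((p - 1) div 2)"
proof (rule digit_weight_le_one_digit)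
  have "(p + 1) div 2 + (p - 3) div 2 = p - 1" using assms(1,2) by presburger
  hence "[d * 1 + (p - 3) div 2 = p - 1] (mod (p - 1))"
    using cong_add[OF assms(3) cong_refl, of "(p - 3) div 2"] by simp
  thus "(p - 1) dvd d * 1 + (p - 3) div 2" by (simp only: cong_dvd_iff dvd_refl)
  show "\<not> (p - 1) dvd 1" using assms(1) by simp
  show "1 + (p - 3) div 2 \<le> (p - 1) div 2" using assms(1) by presburger
qed

lemma exists_less_dvd_add:
  fixes j m :: nat
  assumes "m > 0"
  shows "\<exists>b<m. m dvd j + b"
proof -
  define b where "b = (m - 1) * j mod m"
  have "[j + b = j + (m - 1) * j] (mod m)" unfolding b_def by (simp add: cong_def mod_add_right_eq)
  moreover have "j + (m - 1) * j = m * j" using assms by (cases m) simp_all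
  ultimately have "m dvd j + b" by (metis cong_dvd_iff dvd_triv_left)
  thus ?thesis using assms by (intro exI[of _ b]) (simp add: b_def)
qed

lemma Suc_dvd_shifted_multiple:
  fixes h b :: nat
  assumes "h > 0" "b = h \<or> b = 2 * h + 1"
  shows "h + 1 dvd h - 1 + 2 * h * b"
proof -
  obtain m where m: "h = Suc m" using assms(1) gr0_conv_Suc by blast
  from assms(2) show ?thesis
  proof
    assume "b = h"
    hence "h - 1 + 2 * h * b = (h + 1) * (2 * h - 1)" by (simp add: m algebra_simps)
    thus ?thesis by (metis dvd_triv_left)
  next
    assume "b = 2 * h + 1"
    hence "h - 1 + 2 * h * b = (h + 1) * (4 * h - 1)" by (simp add: m algebra_simps)
    thus ?thesis by (metis dvd_triv_left)
  qed
qed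

lemma exists_digit_of_exceptional_exponent:
  fixes h d :: nat
  assumes "h > 0" "[d = h + 1] (mod (2 * h))" and cop: "coprime d (4 * h * (h + 1))"
  obtains b where "4 * h * (h + 1) dvd d + (h - 1 + 2 * h * b)" "b \<le> 2 * h" "b \<noteq> h"
proof -
  have "[d + (h - 1) = (h + 1) + (h - 1)] (mod (2 * h))" using cong_add[OF assms(2) cong_refl] .
  hence "2 * h dvd d + (h - 1)" using assms(1) by (simp add: cong_def dvd_eq_mod_eq_0 mult_2)
  then obtain j where j: "d + (h - 1) = 2 * h * j" by blast
  obtain b where b: "b < 2 * (h + 1)" "2 * (h + 1) dvd j + b"
    using exists_less_dvd_add[of "2 * (h + 1)" j] by auto
  have "2 * h * (2 * (h + 1)) dvd 2 * h * (j + b)" using b(2) by (rule mult_dvd_mono[OF dvd_refl])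
  moreover have "2 * h * (j + b) = d + (h - 1 + 2 * h * b)" by (simp add: distrib_left flip: j)
  moreover have "2 * h * (2 * (h + 1)) = 4 * h * (h + 1)" by simp
  ultimately have dvd: "4 * h * (h + 1) dvd d + (h - 1 + 2 * h * b)" by (simp only:)
  have "\<not> h + 1 dvd h - 1 + 2 * h * b"
  proof
    assume "h + 1 dvd h - 1 + 2 * h * b"
    moreover have "h + 1 dvd d + (h - 1 + 2 * h * b)" using dvd by (rule dvd_mult_right)
    ultimately have "h + 1 dvd d" by (simp add: dvd_add_left_iff)
    hence "is_unit (h + 1)" using cop by (meson coprime_common_divisor dvd_triv_right)
    thus False using assms(1) by simp
  qed
  hence "b \<noteq> h" "b \<noteq> 2 * h + 1" using Suc_dvd_shifted_multiple[OF assms(1)] by blast+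
  thus ?thesis using b(1) by (intro that[OF dvd]) auto
qed

lemma digit_weight_le_two_digits_multiplier:
  assumes e: "(p\<^sup>2 - 1) dvd d + e" "e * (a\<^sub>0 + a\<^sub>1 * p) = (b\<^sub>0 + b\<^sub>1 * p) + r * (p\<^sup>2 - 1)"
    and a: "0 < a\<^sub>0 + a\<^sub>1 * p" "a\<^sub>0 + a\<^sub>1 * p < p\<^sup>2 - 1" and "a\<^sub>0 + a\<^sub>1 + b\<^sub>0 + b\<^sub>1 = w"
  shows "digit_weight_le p 2 d w"
proof (rule digit_weight_le_two_digits)
  have "[e * (a\<^sub>0 + a\<^sub>1 * p) = b\<^sub>0 + b\<^sub>1 * p] (mod (p\<^sup>2 - 1))"
    unfolding e(2) cong_def by (rule mod_mult_self1)
  thus "(p\<^sup>2 - 1) dvd d * (a\<^sub>0 + a\<^sub>1 * p) + (b\<^sub>0 + b\<^sub>1 * p)" by (rule dvd_mult_add_if_cong[OF e(1)])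
  show "\<not> (p\<^sup>2 - 1) dvd a\<^sub>0 + a\<^sub>1 * p" using a by (rule nat_dvd_not_less)
qed (use assms(5) in simp)

lemma digit_weight_le_two_digits_half:
  fixes p h d b :: nat
  assumes p: "p = 2 * h + 1" "h \<ge> 5" and dvd: "4 * h * (h + 1) dvd d + (h - 1 + 2 * h * b)"
    and b: "b \<le> 2 * h" "b \<noteq> h"
  shows "digit_weight_le p 2 d h"
proof -
  have P: "p\<^sup>2 - 1 = 4 * h * (h + 1)" by (simp add: p power2_eq_square algebra_simps)
  have small: "9 * h < 4 * h * (h + 1)" using p by simp
  have weight: ?thesis
    if "(h - 1 + 2 * h * b) * (a\<^sub>0 + a\<^sub>1 * p) = (b\<^sub>0 + b\<^sub>1 * p) + r * (4 * h * (h + 1))"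
      and "0 < a\<^sub>0 + a\<^sub>1 * p" "a\<^sub>0 + a\<^sub>1 * p \<le> 9 * h" and "a\<^sub>0 + a\<^sub>1 + b\<^sub>0 + b\<^sub>1 = h"
    for a\<^sub>0 a\<^sub>1 b\<^sub>0 b\<^sub>1 r
    by (rule digit_weight_le_two_digits_multiplier
        [where p = p, unfolded P, OF dvd that(1,2) _ that(4)]) (use that(3) small in linarith)
  obtain k where k: "h = 5 + k" using le_Suc_ex[OF p(2)] by blast
  \<comment> \<open>\<open>- d \<equiv> h - 1 + 2 * h * b = (h - 1 - b) + b * p\<close>, so for \<open>b < h\<close> the pair of \<open>1\<close> and \<open>- d\<close> has
    weight \<open>h\<close>; for other \<open>b\<close> a multiple of it by \<open>4 + p\<close>, \<open>1 + 2 * p\<close> or \<open>1 + 4 * p\<close> does.\<close>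
  consider "b < h" | "b = h + 1" | "h + 2 \<le> b" "b < 2 * h" | "b = 2 * h" using b by linarith
  thus ?thesis
  proof cases
    case 1
    obtain c where "h = Suc (b + c)" using less_imp_Suc_add[OF 1] by blast
    thus ?thesis
      using p(1) by (intro weight[of 1 0 c b 0]) (simp_all add: algebra_simps)
  next
    case 2
    thus ?thesis
      using p(1) k by (intro weight[of 4 1 k 0 "h + 3"]) (simp_all add: algebra_simps)
  next
    case 3
    obtain c where c: "b = h + 2 + c" using le_Suc_ex[OF 3(1)] by blast
    obtain c' where "2 * h = Suc (b + c')" using less_imp_Suc_add[OF 3(2)] by blast
    hence "h = c + c' + 3" using c by simp
    thus ?thesis
      using p(1) c by (intro weight[of 1 2 c c' "2 * b"]) (simp_all add: algebra_simps)
  next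
    case 4
    thus ?thesis
      using p(1) k by (intro weight[of 1 4 k 0 "8 * h - 1"]) (simp_all add: algebra_simps)
  qed
qed

lemma digit_weight_le_exceptional_even:
  fixes p d :: nat
  assumes p: "prime p" "p \<ge> 5" "[p = 1] (mod 4)"
    and d: "coprime d (p\<^sup>2 - 1)" "[d = (p + 1) div 2] (mod (p - 1))"
  shows "digit_weight_le p 2 d (2 * ((p + 1) div 3))"
proof -
  define h where "h = (p - 1) div 2"
  have h: "p = 2 * h + 1" using p unfolding h_def cong_def by presburger
  hence P: "p\<^sup>2 - 1 = 4 * h * (h + 1)" by (simp add: power2_eq_square algebra_simps)
  show ?thesis
  proof (cases "p = 5")
    case True
    hence "4 dvd d + 1" using d(2) unfolding cong_def by presburger
    hence "6 * 4 dvd 6 * (d + 1)" by (rule mult_dvd_mono[OF dvd_refl])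
    thus ?thesis
      using True by (intro digit_weight_le_two_digits[of _ _ 1 1 1 1]) (simp_all add: algebra_simps)
  next
    case False
    have "p \<noteq> 9" using p(1) by auto
    hence "h \<ge> 6" using False p(2,3) h unfolding cong_def by presburger
    obtain b where "4 * h * (h + 1) dvd d + (h - 1 + 2 * h * b)" "b \<le> 2 * h" "b \<noteq> h"
      by (rule exists_digit_of_exceptional_exponent[of h d]) (use d P h \<open>h \<ge> 6\<close> in auto)
    hence "digit_weight_le p 2 d h"
      using h \<open>h \<ge> 6\<close> by (intro digit_weight_le_two_digits_half) auto
    moreover have "h \<le> 2 * ((p + 1) div 3)" using h by presburger
    ultimately show ?thesis by (rule digit_weight_le_mono)
  qed
qed

section \<open>The bound for Weil sums\<close>

lemma power_minus_1_eq_nat: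
  fixes x :: nat
  assumes "x > 0"
  shows "x ^ m - 1 = (x - 1) * (\<Sum>i<m. x ^ i)"
proof -
  have "int (x ^ m - 1) = int ((x - 1) * (\<Sum>i<m. x ^ i))"
    using assms power_diff_1_eq[of "int x" m] by (simp add: of_nat_diff Suc_le_eq)
  thus ?thesis by (simp only: of_nat_eq_iff)
qed

lemma power_minus_1_dvd_nat:
  fixes x :: nat
  assumes "x > 0"
  shows "(x ^ s - 1) dvd (x ^ (h * s) - 1)"
  using power_minus_1_eq_nat[of "x ^ s" h] assms by (simp add: mult.commute[of h] power_mult)

lemma sum_periodic_digits:
  fixes x :: "'b :: comm_semiring_1"
  shows "(\<Sum>i<h * s. f (i mod s) * x ^ i) = (\<Sum>i<s. f i * x ^ i) * (\<Sum>j<h. (x ^ s) ^ j)"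
proof -
  have block: "(\<Sum>i = j * s..<j * s + s. f (i mod s) * x ^ i)
      = (\<Sum>i<s. f i * x ^ i) * (x ^ s) ^ j" for j
  proof -
    have "(\<Sum>i = j * s..<j * s + s. f (i mod s) * x ^ i) = (\<Sum>i<s. f i * x ^ (j * s + i))"
      by (rule sum.reindex_bij_witness[of _ "\<lambda>i. j * s + i" "\<lambda>i. i - j * s"])
        (auto simp: le_iff_add)
    moreover have "x ^ (j * s + i) = x ^ i * (x ^ s) ^ j" for i
      by (simp add: power_add mult.commute flip: power_mult)
    ultimately show ?thesis by (simp add: sum_distrib_right mult.assoc)
  qed
  show ?thesis unfolding sum.nat_group[symmetric] block sum_distrib_left ..
qed

lemma weil_val_le_digit_weight:
  assumes F: "finite_field_of_degree TYPE('a :: finite_field) p (h * s)"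
    and d: "coprime d (CARD('a) - 1)" "d > 0" and w: "digit_weight_le p s d w"
  shows "weil_val TYPE('a) d \<le> ereal (real (h * w) / (real p - 1))"
proof -
  obtain R and red :: "complex \<Rightarrow> 'a" where "cyclotomic_reduction p (h * s) R red"
    using exists_cyclotomic_reduction[OF F] .
  then interpret cyclotomic_reduction p "h * s" R red .
  obtain a b :: "nat \<Rightarrow> nat"
    where ab: "(p ^ s - 1) dvd d * (\<Sum>i<s. a i * p ^ i) + (\<Sum>i<s. b i * p ^ i)"
      "\<not> (p ^ s - 1) dvd (\<Sum>i<s. a i * p ^ i)" and weight: "(\<Sum>i<s. a i + b i) \<le> w"
    using w unfolding digit_weight_le_def by blast
  define N where "N = (\<Sum>j<h. (p ^ s) ^ j)"
  have q: "CARD('a) - 1 = (p ^ s - 1) * N"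
    unfolding N_def CARD_eq mult.commute[of h] power_mult
    using p_gt_1 by (intro power_minus_1_eq_nat) simp
  hence "N > 0" using CARD_finite_field_gt_1[where 'a = 'a] by (cases "N = 0") auto
  have "weil_val TYPE('a) d \<le> ereal (real (\<Sum>i<h * s. a (i mod s) + b (i mod s)) / (real p - 1))"
  proof (rule weil_val_le_digit_sum[OF d])
    show "(CARD('a) - 1) dvd d * (\<Sum>i<h * s. a (i mod s) * p ^ i) + (\<Sum>i<h * s. b (i mod s) * p ^ i)"
      unfolding sum_periodic_digits q N_def[symmetric]
      using ab(1) by (simp add: mult_dvd_mono flip: mult.assoc distrib_right)
    show "\<not> (CARD('a) - 1) dvd (\<Sum>i<h * s. a (i mod s) * p ^ i)"
      unfolding sum_periodic_digits q N_def[symmetric] using \<open>N > 0\<close> ab(2) by simp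
  qed
  also have "(\<Sum>i<h * s. a (i mod s) + b (i mod s)) = h * (\<Sum>i<s. a i + b i)"
    using sum_periodic_digits[where x = "1 :: nat" and f = "\<lambda>i. a i + b i"] by simp
  also have "ereal (real (h * (\<Sum>i<s. a i + b i)) / (real p - 1))
      \<le> ereal (real (h * w) / (real p - 1))"
    using weight p_gt_1 by (simp add: divide_right_mono mult_left_mono del: of_nat_sum of_nat_add)
  finally show ?thesis .
qed

lemma ceiling_minus_1_div_3: "\<lceil>(real p - 1) / 3\<rceil> = int ((p + 1) div 3)"
proof (rule ceiling_unique)
  define k where "k = (p + 1) div 3"
  have "3 * k \<le> p + 1" "p + 1 < 3 * k + 3" unfolding k_def by presburger+
  hence "3 * real k \<le> real p + 1" "real p + 1 < 3 * real k + 3" by linarith+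
  thus "real_of_int (int ((p + 1) div 3)) - 1 < (real p - 1) / 3"
    "(real p - 1) / 3 \<le> real_of_int (int ((p + 1) div 3))"
    by (simp_all add: k_def[symmetric])
qed

lemma weil_val_le_third:
  assumes "finite_field_of_degree TYPE('a :: finite_field) p (h * s)"
    and "coprime d (CARD('a) - 1)" "d > 0" "digit_weight_le p s d (s * ((p + 1) div 3))"
  shows "weil_val TYPE('a) d \<le> ereal (1 / (real p - 1) * of_int \<lceil>(real p - 1) / 3\<rceil> * real (h * s))"
  using weil_val_le_digit_weight[OF assms] unfolding ceiling_minus_1_div_3 by (simp add: mult_ac)

lemma weil_val_le_half:
  assumes "finite_field_of_degree TYPE('a :: finite_field) p n"
    and "coprime d (CARD('a) - 1)" "d > 0" and p: "p > 1" "odd p"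
    and "digit_weight_le p 1 d ((p - 1) div 2)"
  shows "weil_val TYPE('a) d \<le> ereal (1 / 2 * real n)"
proof -
  have "weil_val TYPE('a) d \<le> ereal (real (n * ((p - 1) div 2)) / (real p - 1))"
    using assms by (intro weil_val_le_digit_weight[where s = 1]) simp_all
  also have "real (n * ((p - 1) div 2)) / (real p - 1) = 1 / 2 * real n"
    using p by (auto elim!: oddE simp: field_simps)
  finally show ?thesis .
qed

theorem theorem5p1:
  fixes p n d q :: nat
  assumes "CHAR('a::finite_field) = p"
    and "CARD('a) = q"
    and "q = p ^ n"
    and "d > 0"
    and "gcd d (q - 1) = 1"
    and "\<not> [d = 1] (mod (p - 1))"
  shows "([d = (p + 1) div 2] (mod (p - 1)) \<longrightarrow> [p = 1] (mod 4)) \<and>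
    (if [d = (p + 1) div 2] (mod (p - 1)) \<and> odd n
     then weil_val TYPE('a) d \<le> ereal (1 / 2 * real n)
     else weil_val TYPE('a) d
            \<le> ereal (1 / (real p - 1) * of_int \<lceil>(real p - 1) / 3\<rceil> * real n))"
proof -
  let ?third = "weil_val TYPE('a) d \<le> ereal (1 / (real p - 1) * of_int \<lceil>(real p - 1) / 3\<rceil> * real n)"
  have F: "finite_field_of_degree TYPE('a) p n" using assms(1-3) by unfold_locales auto
  then interpret finite_field_of_degree "TYPE('a)" p n .
  have d: "coprime d (CARD('a) - 1)" "d > 0" using assms by (simp_all add: coprime_iff_gcd_eq_1)
  have coprime_period: "coprime d (p ^ s - 1)" if "n = h * s" for h s
    using power_minus_1_dvd_nat[OF p_pos] d(1) unfolding CARD_eq that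
    by (rule coprime_divisors[OF dvd_refl])
  have coprime_p: "coprime d (p - 1)" using coprime_period[of n 1] by simp
  note bounds = nontrivial_exponent_bounds[OF prime_p coprime_p assms(6)]
  have mod_4: "[p = 1] (mod 4)" if "[d = (p + 1) div 2] (mod (p - 1))"
    using exceptional_exponent_imp_cong_1_mod_4[OF bounds(2,3) that] .
  have half: "weil_val TYPE('a) d \<le> ereal (1 / 2 * real n)" if "[d = (p + 1) div 2] (mod (p - 1))"
    using digit_weight_le_exceptional[OF bounds(1,2) that]
    by (rule weil_val_le_half[OF F d p_gt_1 bounds(2)])
  have generic: ?third if "\<not> [d = (p + 1) div 2] (mod (p - 1))"
    using weil_val_le_third[of p n 1] F d digit_weight_le_generic[OF prime_p coprime_p assms(6) that]
    by simp
  have even: ?third if "[d = (p + 1) div 2] (mod (p - 1))" and n: "n = h * 2" for h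
    using digit_weight_le_exceptional_even[OF prime_p bounds(1) mod_4 coprime_period[OF n]] that
      weil_val_le_third[OF F[unfolded n] d] by simp
  show ?thesis
    using mod_4 half generic even[of "n div 2"]
    by (cases "[d = (p + 1) div 2] (mod (p - 1))") auto
qed

end
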